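(* For every $\varepsilon>0$ there exists an integer $d_0(\varepsilon)>0$ such that for every fixed integer $d\geq d_0$, if $G$ is the uniformly random $d$-regular graph on the vertex set $[n]$ (with $dn$ even), then with probability tending to $1$ as $n\to\infty$, $$r_\ell(G,\mathcal{HAM})\geq (1-\varepsilon)d/6.$$
   Context: For a monotone increasing graph property $\mathcal{P}$ and a graph $G$, the local resilience is $r_\ell(G,\mathcal{P})=\min\{r: \exists H\subseteq G \text{ with } \Delta(H)=r \text{ and } G- H\notin\mathcal{P}\}$, where $H\subseteq G$ is a subgraph on the same vertex set, $\Delta(H)$ its maximum degree, and $G-H$ the graph obtained by deleting the edges of $H$. $\mathcal{HAM}$ denotes the property of being Hamiltonian. *)

theory Defs
  imports "HOL-Probability.Probability"
begin

datatype 'a ugraph = UGraph (verts: "'a set") (edges: "'a set set")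

definition simple_graph :: "'a ugraph \<Rightarrow> bool" where
  "simple_graph G \<longleftrightarrow> finite (verts G) \<and> (\<forall>e\<in>edges G. e \<subseteq> verts G \<and> card e = 2)"

definition degree :: "'a ugraph \<Rightarrow> 'a \<Rightarrow> nat" where
  "degree G v = card {e \<in> edges G. v \<in> e}"

definition max_degree :: "'a ugraph \<Rightarrow> nat" where
  "max_degree G = Max (degree G ` verts G)"

definition regular :: "nat \<Rightarrow> 'a ugraph \<Rightarrow> bool" where
  "regular d G \<longleftrightarrow> (\<forall>v\<in>verts G. degree G v = d)"

definition spanning_subgraph :: "'a ugraph \<Rightarrow> 'a ugraph \<Rightarrow> bool" where
  "spanning_subgraph H G \<longleftrightarrow> verts H = verts G \<and> edges H \<subseteq> edges G"

definition delete_edges :: "'a ugraph \<Rightarrow> 'a ugraph \<Rightarrow> 'a ugraph" where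
  "delete_edges G H = UGraph (verts G) (edges G - edges H)"

text \<open>A graph property is a set of graphs.  The minimum exists whenever the edgeless graph on
  the vertex set of \<open>G\<close> is not in \<open>P\<close>; otherwise the value is unspecified.\<close>

definition local_resilience :: "'a ugraph \<Rightarrow> 'a ugraph set \<Rightarrow> nat" where
  "local_resilience G P =
     (LEAST r. \<exists>H. spanning_subgraph H G \<and> max_degree H = r \<and> delete_edges G H \<notin> P)"

text \<open>A Hamilton cycle is given by listing the vertices in cyclic order.  It has length at
  least 3, so graphs on fewer than three vertices are not Hamiltonian.\<close>

definition hamilton_cycle :: "'a ugraph \<Rightarrow> 'a list \<Rightarrow> bool" where
  "hamilton_cycle G vs \<longleftrightarrow>
     distinct vs \<and> set vs = verts G \<and> length vs \<ge> 3 \<and>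
     (\<forall>i<length vs. {vs ! i, vs ! (Suc i mod length vs)} \<in> edges G)"

definition HAM :: "'a ugraph set" where
  "HAM = {G. simple_graph G \<and> (\<exists>vs. hamilton_cycle G vs)}"

definition regular_graphs :: "nat \<Rightarrow> nat \<Rightarrow> nat ugraph set" where
  "regular_graphs n d = {G. simple_graph G \<and> verts G = {1..n} \<and> regular d G}"

text \<open>Only meaningful when \<open>regular_graphs n d\<close> is nonempty, i.e. when \<open>d * n\<close> is even and
  \<open>d < n\<close> (or \<open>n = 0\<close>).\<close>

definition random_regular_graph :: "nat \<Rightarrow> nat \<Rightarrow> nat ugraph pmf" where
  "random_regular_graph n d = pmf_of_set (regular_graphs n d)"

lemma finite_regular_graphs: "finite (regular_graphs n d)"
proof (rule finite_subset)
  show "regular_graphs n d \<subseteq> (\<lambda>E. UGraph {1..n} E) ` Pow (Pow {1..n})"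
  proof
    fix G assume "G \<in> regular_graphs n d"
    then have "verts G = {1..n}" and E: "edges G \<in> Pow (Pow {1..n})"
      unfolding regular_graphs_def simple_graph_def by auto
    then have "G = UGraph {1..n} (edges G)" by (metis ugraph.collapse)
    with E show "G \<in> (\<lambda>E. UGraph {1..n} E) ` Pow (Pow {1..n})" by (metis imageI)
  qed
qed simp

lemma HAM_mono:
  assumes "G \<in> HAM" "spanning_subgraph G G'" "simple_graph G'"
  shows "G' \<in> HAM"
proof -
  obtain vs where "hamilton_cycle G vs" using assms(1) unfolding HAM_def by blast
  then have "hamilton_cycle G' vs"
    using assms(2) unfolding hamilton_cycle_def spanning_subgraph_def by (metis subsetD)
  then show ?thesis using assms(3) unfolding HAM_def by blast
qed

lemma edgeless_not_HAM: "UGraph V {} \<notin> HAM"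
proof
  assume "UGraph V {} \<in> HAM"
  then obtain vs where "hamilton_cycle (UGraph V {}) vs" unfolding HAM_def by blast
  then have "3 \<le> length vs" "\<forall>i<length vs. {vs ! i, vs ! (Suc i mod length vs)} \<in> {}"
    unfolding hamilton_cycle_def ugraph.sel by blast+
  then have "3 \<le> length vs" "\<not> 0 < length vs" by blast+
  then show False by linarith
qed

lemma local_resilience_HAM_attained:
  "\<exists>H. spanning_subgraph H G \<and> max_degree H = local_resilience G HAM \<and> delete_edges G H \<notin> HAM"
proof -
  have "delete_edges G G \<notin> HAM" by (simp add: delete_edges_def edgeless_not_HAM)
  moreover have "spanning_subgraph G G" by (simp add: spanning_subgraph_def)
  ultimately have "\<exists>r H. spanning_subgraph H G \<and> max_degree H = r \<and> delete_edges G H \<notin> HAM"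
    by blast
  then show ?thesis unfolding local_resilience_def by (rule LeastI_ex)
qed

end

theory Submission
  imports Defs
begin

text \<open>
  Let \<open>E\<close> be the random \<open>d\<close>-regular graph and \<open>H\<close> a subgraph of maximum degree at most \<open>d / 6\<close>.
  Inside \<open>E - H\<close> one chooses a sparse subgraph \<open>\<Gamma>\<close> with at most \<open>\<kappa> n d\<close> edges: a small multiple of \<open>d\<close> edges at
  each vertex makes small sets expand (because small sets are sparse in \<open>E\<close>), and a greedy hitting set of edges makes large
  sets expand (because \<open>E\<close> has about \<open>|A| |B| d / n\<close> edges between \<open>A\<close> and \<open>B\<close>, of which \<open>H\<close> can
  destroy at most \<open>|A| d / 6\<close>).  By Posa's rotations, every end of a longest path of \<open>\<Gamma>\<close> has more than
  \<open>n / 4\<close> partner ends, and adding such a pair of ends (a booster) closes a Hamilton cycle or lengthens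
  the longest path.  The set of boosters depends only on \<open>\<Gamma>\<close>, so a union bound over all sparse \<open>\<Gamma>\<close>
  shows that \<open>E\<close> contains about the expected number of them, more than \<open>H\<close> can destroy.  Adding
  boosters of \<open>E - H\<close> at most \<open>n + 1\<close> times thus yields a Hamilton cycle.

  All probability estimates rest on one bound, obtained by switching \<open>uv, xy\<close> to \<open>ux, vy\<close>: a fixed set
  of \<open>m\<close> edges lies in \<open>E\<close> with probability at most about \<open>(d / n) ^ m\<close>, even when \<open>m\<close> is a small
  multiple of \<open>n d\<close>.  No contiguity with the configuration model is needed.
\<close>

section \<open>Graphs as sets of edges\<close>

definition pairs :: "'a set \<Rightarrow> 'a set set" where
  "pairs V = {e. e \<subseteq> V \<and> card e = 2}"

definition nbrs :: "'a set set \<Rightarrow> 'a \<Rightarrow> 'a set" where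
  "nbrs E v = {w. {v, w} \<in> E}"

lemma pairsE:
  assumes "e \<in> pairs V"
  obtains a b where "a \<in> V" "b \<in> V" "a \<noteq> b" "e = {a, b}"
  using assms unfolding pairs_def by (auto simp: card_2_iff)

lemma pair_in_pairs [simp]: "{a, b} \<in> pairs V \<longleftrightarrow> a \<in> V \<and> b \<in> V \<and> a \<noteq> b"
  unfolding pairs_def by (auto simp: card_2_iff doubleton_eq_iff)

lemma singleton_notin_pairs [simp]: "{a} \<notin> pairs V"
  unfolding pairs_def by simp

lemma finite_pairs: "finite V \<Longrightarrow> finite (pairs V)"
  unfolding pairs_def by auto

lemma card_pairs_le:
  assumes "finite V"
  shows "real (card (pairs V)) \<le> real (card V) ^ 2 / 2"
proof -
  have "card (pairs V) = card V choose 2"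
    unfolding pairs_def using n_subsets[OF assms, of 2] by simp
  also have "real \<dots> = real (card V) * (real (card V) - 1) / 2"
  proof (cases "card V")
    case (Suc m)
    have "2 * (card V choose 2) = card V * (card V - 1)"
      unfolding choose_two by (rule dvd_mult_div_cancel) (cases "card V", auto)
    then have "2 * real (card V choose 2) = real (card V) * real (card V - 1)"
      by (metis of_nat_mult of_nat_numeral)
    then show ?thesis using Suc by simp
  qed simp
  also have "\<dots> \<le> real (card V) ^ 2 / 2" by (simp add: power2_eq_square algebra_simps)
  finally show ?thesis .
qed

lemma nbrs_subset: "E \<subseteq> pairs V \<Longrightarrow> nbrs E v \<subseteq> V - {v}"
  unfolding nbrs_def by auto

lemma nbrs_mono: "E \<subseteq> E' \<Longrightarrow> nbrs E v \<subseteq> nbrs E' v"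
  unfolding nbrs_def by auto

lemma card_nbrs:
  assumes "E \<subseteq> pairs V"
  shows "card (nbrs E v) = card {e \<in> E. v \<in> e}"
proof (rule bij_betw_same_card[of "\<lambda>w. {v, w}"])
  show "bij_betw (\<lambda>w. {v, w}) (nbrs E v) {e \<in> E. v \<in> e}"
  proof (rule bij_betw_imageI)
    show "inj_on (\<lambda>w. {v, w}) (nbrs E v)"
      by (auto simp: inj_on_def doubleton_eq_iff)
    show "(\<lambda>w. {v, w}) ` nbrs E v = {e \<in> E. v \<in> e}"
    proof (intro equalityI subsetI)
      fix e assume e: "e \<in> {e \<in> E. v \<in> e}"
      then have "e \<in> pairs V" using assms by blast
      then obtain a b where "e = {a, b}" by (rule pairsE)
      with e show "e \<in> (\<lambda>w. {v, w}) ` nbrs E v"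
        unfolding nbrs_def by (auto simp: insert_commute)
    qed (auto simp: nbrs_def)
  qed
qed

lemma card_arcs:
  assumes "finite E" "E \<subseteq> pairs V"
  shows "finite {(x, y). {x, y} \<in> E} \<and> card {(x, y). {x, y} \<in> E} = 2 * card E"
  using assms
proof (induction E rule: finite_induct)
  case (insert e E)
  then obtain a b where ab: "a \<noteq> b" "e = {a, b}" by (auto elim: pairsE)
  have eq: "{(x, y). {x, y} \<in> insert e E} = {(a, b), (b, a)} \<union> {(x, y). {x, y} \<in> E}"
    using ab by (auto simp: doubleton_eq_iff)
  have "(a, b) \<notin> {(x, y). {x, y} \<in> E}" "(b, a) \<notin> {(x, y). {x, y} \<in> E}"
    using insert ab by (auto simp: insert_commute)
  then show ?case unfolding eq using insert ab by simp
qed simp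

lemma sum_card_nbrs:
  assumes "finite V" "E \<subseteq> pairs V"
  shows "(\<Sum>v\<in>V. card (nbrs E v)) = 2 * card E"
proof -
  have "{(x, y). {x, y} \<in> E} = Sigma V (nbrs E)"
    using assms(2) unfolding nbrs_def by auto
  moreover have "finite (nbrs E v)" for v
    using nbrs_subset[OF assms(2)] assms(1) by (meson finite_Diff finite_subset)
  moreover have "finite E" using assms finite_pairs finite_subset by blast
  ultimately show ?thesis
    using card_arcs[of E V] assms by (simp add: card_SigmaI)
qed

text \<open>The external neighbourhood, which is what Posa's lemma bounds.\<close>

definition nbhd :: "'a set set \<Rightarrow> 'a set \<Rightarrow> 'a set" where
  "nbhd E T = (\<Union>t\<in>T. nbrs E t) - T"

section \<open>Rotations and boosters\<close>

definition is_path :: "'a set set \<Rightarrow> 'a list \<Rightarrow> bool" where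
  "is_path E p \<longleftrightarrow> p \<noteq> [] \<and> distinct p \<and> successively (\<lambda>x y. {x, y} \<in> E) p"

definition longest :: "'a set \<Rightarrow> 'a set set \<Rightarrow> 'a list \<Rightarrow> bool" where
  "longest V E p \<longleftrightarrow> is_path E p \<and> set p \<subseteq> V \<and>
     (\<forall>q. is_path E q \<longrightarrow> set q \<subseteq> V \<longrightarrow> length q \<le> length p)"

definition steps :: "'a list \<Rightarrow> 'a set set" where
  "steps p = {{a, b} | a b xs ys. p = xs @ a # b # ys}"

lemma is_path_rev: "is_path E p \<Longrightarrow> is_path E (rev p)"
  unfolding is_path_def by (simp add: successively_rev insert_commute)

lemma longest_rev: "longest V E p \<Longrightarrow> longest V E (rev p)"
  unfolding longest_def using is_path_rev by auto

lemma longest_exists: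
  assumes "finite V" "V \<noteq> {}"
  shows "\<exists>p. longest V E p"
proof -
  obtain v where "v \<in> V" using assms by auto
  then have ex: "is_path E [v] \<and> set [v] \<subseteq> V" by (simp add: is_path_def)
  have "length q < Suc (card V)" if "is_path E q \<and> set q \<subseteq> V" for q
    using that card_mono[OF assms(1), of "set q"] by (simp add: is_path_def distinct_card)
  then have b: "\<forall>q. is_path E q \<and> set q \<subseteq> V \<longrightarrow> length q < Suc (card V)" by blast
  from ex_has_greatest_nat[of "\<lambda>q. is_path E q \<and> set q \<subseteq> V" "[v]" length "Suc (card V)"] ex b
  show ?thesis unfolding longest_def by (metis less_imp_le)
qed

lemma longest_length: "longest V E p \<Longrightarrow> longest V E q \<Longrightarrow> length p = length q"
  unfolding longest_def by (simp add: le_antisym)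

lemma longest_same:
  "longest V E p \<Longrightarrow> is_path E q \<Longrightarrow> set q = set p \<Longrightarrow> longest V E q"
  unfolding longest_def is_path_def by (metis distinct_card)

text \<open>Posa rotations with the first vertex fixed: the step from \<open>w\<close> to
  \<open>hd ys\<close> is exchanged for the edge from \<open>w\<close> to \<open>last ys\<close>,
  and \<open>hd ys\<close> becomes the new last vertex.\<close>

inductive rots :: "'a set set \<Rightarrow> 'a list \<Rightarrow> 'a list \<Rightarrow> bool" for E p where
  base: "rots E p p"
| rotate: "rots E p (xs @ w # ys) \<Longrightarrow> ys \<noteq> [] \<Longrightarrow> {w, last ys} \<in> E \<Longrightarrow> rots E p (xs @ w # rev ys)"

lemma is_path_rotate:
  assumes "is_path E (xs @ w # ys)" "ys \<noteq> []" "{w, last ys} \<in> E"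
  shows "is_path E (xs @ w # rev ys)"
  using assms unfolding is_path_def
  by (auto simp: successively_append_iff successively_Cons successively_rev hd_rev insert_commute)

lemma rots_path:
  assumes "rots E p q" "is_path E p"
  shows "is_path E q \<and> set q = set p \<and> hd q = hd p"
  using assms
proof induction
  case (rotate xs w ys)
  have ih: "is_path E (xs @ w # ys)" "set (xs @ w # ys) = set p" "hd (xs @ w # ys) = hd p"
    using rotate.IH[OF rotate.prems] by simp_all
  have "is_path E (xs @ w # rev ys)" using is_path_rotate[OF ih(1) rotate.hyps(2,3)] .
  moreover have "hd (xs @ w # rev ys) = hd (xs @ w # ys)" by (cases xs) simp_all
  ultimately show ?case using ih by simp
qed simp

lemma steps_append:
  assumes "ys \<noteq> []"
  shows "steps (xs @ w # ys) = steps (xs @ [w]) \<union> insert {w, hd ys} (steps ys)"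
proof -
  have A: "steps (a # b # zs) = insert {a, b} (steps (b # zs))" for a b :: 'a and zs
    unfolding steps_def by (auto simp: Cons_eq_append_conv) blast+
  have B: "steps [a] = {}" for a :: 'a unfolding steps_def by (auto simp: Cons_eq_append_conv)
  have "steps (w # ys) = insert {w, hd ys} (steps ys)" using A assms by (cases ys) auto
  moreover have "steps (xs @ w # ys) = steps (xs @ [w]) \<union> steps (w # ys)"
  proof (induction xs)
    case Nil then show ?case using B by simp
  next
    case (Cons x xs) then show ?case using A by (cases xs) auto
  qed
  ultimately show ?thesis by simp
qed

lemma steps_rev_subset: "steps (rev p) \<subseteq> steps p"
proof
  fix e assume "e \<in> steps (rev p)"
  then obtain a b xs ys where e: "e = {a, b}" "rev p = xs @ a # b # ys" unfolding steps_def by auto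
  then have "p = rev ys @ b # a # rev xs" by (metis append.assoc append_Cons append_Nil rev.simps(2) rev_append rev_rev_ident)
  then show "e \<in> steps p" unfolding steps_def using e(1) by (auto simp: insert_commute)
qed

lemma steps_rev: "steps (rev p) = steps p"
  using steps_rev_subset[of p] steps_rev_subset[of "rev p"] by auto

lemma steps_rotate:
  assumes "ys \<noteq> []"
  shows "steps (xs @ w # ys) \<subseteq> insert {w, hd ys} (steps (xs @ w # rev ys))"
  using steps_append[OF assms, of xs w] steps_append[of "rev ys" xs w] assms
  by (auto simp: steps_rev)

text \<open>A rotation destroys only the step between \<open>w\<close> and \<open>hd ys\<close>, and
  it makes \<open>hd ys\<close> the last vertex. So whenever a step of \<open>p\<close> gets lost,
  one of its two vertices becomes an end.\<close>

lemma rots_broken: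
  assumes "rots E p q" "e \<in> steps p" "e \<notin> steps q"
  shows "\<exists>q'. rots E p q' \<and> last q' \<in> e"
  using assms
proof induction
  case (rotate xs w ys)
  show ?case
  proof (cases "e \<in> steps (xs @ w # ys)")
    case True
    then have "e = {w, hd ys}" using steps_rotate[OF rotate.hyps(2), of xs w] rotate.prems by auto
    moreover have "last (xs @ w # rev ys) = hd ys" using rotate.hyps(2) by (simp add: last_rev)
    moreover have "rots E p (xs @ w # rev ys)" using rotate.hyps by (rule rots.rotate)
    ultimately show ?thesis by blast
  qed (use rotate in blast)
qed simp

lemma steps_in: "e \<in> steps zs \<Longrightarrow> e \<subseteq> set zs"
  unfolding steps_def by auto

text \<open>The shape of the list says that \<open>w\<close> is not last. The two cases are path
  degree one and two, which \<open>posa_neighbour\<close> compares between \<open>p\<close> and a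
  rotated path.\<close>

lemma steps_at:
  assumes "distinct (xs @ w # x # ys)"
  shows "{e \<in> steps (xs @ w # x # ys). w \<in> e} =
    (if xs = [] then {{w, x}} else {{last xs, w}, {w, x}})"
proof -
  have w: "w \<notin> set (x # ys)" "w \<notin> set xs" using assms by auto
  have "steps (xs @ w # x # ys) = steps (xs @ [w]) \<union> insert {w, x} (steps (x # ys))"
    using steps_append[of "x # ys" xs w] by simp
  moreover have "{e \<in> steps (x # ys). w \<in> e} = {}"
    using steps_in w by blast
  moreover have "{e \<in> steps (xs @ [w]). w \<in> e} = (if xs = [] then {} else {{last xs, w}})"
  proof (cases xs rule: rev_cases)
    case Nil then show ?thesis by (auto simp: steps_def Cons_eq_append_conv)
  next
    case (snoc zs a)
    have "steps (zs @ a # [w]) = steps (zs @ [a]) \<union> insert {a, w} (steps [w])"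
      using steps_append[of "[w]" zs a] by simp
    moreover have "steps [w] = {}" by (auto simp: steps_def Cons_eq_append_conv)
    moreover have "w \<notin> e" if "e \<in> steps (zs @ [a])" for e
      using steps_in[OF that] w snoc by auto
    ultimately show ?thesis using snoc by auto
  qed
  moreover have "{e \<in> A \<union> insert {w, x} B. w \<in> e} = {e \<in> A. w \<in> e} \<union> insert {w, x} {e \<in> B. w \<in> e}"
    for A B by blast
  ultimately show ?thesis by (simp only: split: if_split) (simp add: insert_commute)
qed

text \<open>The key step of Posa's lemma. If neither \<open>w\<close> nor a neighbour of
  \<open>w\<close> along \<open>p\<close> ever becomes an end, then by \<open>rots_broken\<close>
  the steps of \<open>p\<close> at \<open>w\<close> survive in \<open>q\<close>. Rotating
  \<open>q\<close> at \<open>w\<close> turns the successor of \<open>w\<close> on \<open>q\<close>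
  into an end, and this successor is then a neighbour of \<open>w\<close> along \<open>p\<close> as
  well.\<close>

lemma posa_neighbour:
  assumes p: "longest V E p" and q: "rots E p q" and w: "w \<in> V" "{last q, w} \<in> E" "w \<noteq> last q"
    and notend: "\<And>q'. rots E p q' \<Longrightarrow> last q' \<noteq> w"
  shows "\<exists>q'. rots E p q' \<and> {w, last q'} \<in> steps p"
proof (rule ccontr)
  assume contra: "\<not> ?thesis"
  have pp: "is_path E p" using p unfolding longest_def by simp
  have Q: "is_path E q" "set q = set p" "hd q = hd p" using rots_path[OF q pp] by auto
  have lq: "longest V E q" using longest_same[OF p Q(1,2)] .
  \<comment> \<open>Otherwise \<open>w\<close> could be appended to \<open>q\<close>, against
    maximality.\<close>
  have wq: "w \<in> set q"
  proof (rule ccontr)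
    assume "w \<notin> set q"
    then have "is_path E (q @ [w])"
      using Q(1) w unfolding is_path_def by (auto simp: successively_append_iff)
    moreover have "set (q @ [w]) \<subseteq> V" using lq w unfolding longest_def by auto
    ultimately have "length (q @ [w]) \<le> length q" using lq unfolding longest_def by blast
    then show False by simp
  qed
  then obtain xs zs where "q = xs @ w # zs" by (meson split_list)
  moreover have "zs \<noteq> []" using calculation w by auto
  ultimately obtain x ys where qe: "q = xs @ w # x # ys" by (metis neq_Nil_conv)
  have "{w, last (x # ys)} \<in> E" using w qe by (simp add: insert_commute)
  then have "rots E p (xs @ w # rev (x # ys))"
    using rots.rotate[of E p xs w "x # ys"] q qe by simp
  moreover have "last (xs @ w # rev (x # ys)) = x" by simp
  ultimately have x: "\<exists>q'. rots E p q' \<and> last q' = x" by blast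
  have wp: "w \<in> set p" "w \<noteq> last p" using wq Q notend rots.base by metis+
  then obtain xs' zs' where "p = xs' @ w # zs'" by (meson split_list)
  moreover have "zs' \<noteq> []" using calculation wp by auto
  ultimately obtain x' ys' where pe: "p = xs' @ w # x' # ys'" by (metis neq_Nil_conv)
  have dp: "distinct p" "distinct q" using pp Q is_path_def by auto
  \<comment> \<open>Rotations keep the first vertex, so if \<open>w\<close> has path degree one in
    \<open>p\<close>, it has path degree one in \<open>q\<close>. Hence the inclusion
    \<open>sub\<close> below is an equality, and \<open>{w, x}\<close> is a step of
    \<open>p\<close>.\<close>
  have xx: "xs' = [] \<Longrightarrow> xs = []"
    using Q(3) dp qe pe by (cases xs) auto
  have sub: "{e \<in> steps p. w \<in> e} \<subseteq> {e \<in> steps q. w \<in> e}"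
  proof (safe, rule ccontr)
    fix e assume e: "e \<in> steps p" "w \<in> e" "e \<notin> steps q"
    then obtain q' where q': "rots E p q'" "last q' \<in> e" using rots_broken[OF q] by blast
    then have "last q' \<noteq> w" using notend by blast
    moreover obtain a b where "e = {a, b}" using e(1) unfolding steps_def by auto
    ultimately have "e = {w, last q'}" using q'(2) e(2) by auto
    then show False using contra q'(1) e(1) by blast
  qed
  have "{w, x} \<in> {e \<in> steps p. w \<in> e}"
  proof (cases "xs' = []")
    case True
    then show ?thesis
      using sub xx steps_at[of xs w x ys] steps_at[of xs' w x' ys'] dp qe pe by auto
  next
    case False
    have "last xs' \<noteq> x'" using dp pe False by auto
    then show ?thesis
      using sub steps_at[of xs w x ys] steps_at[of xs' w x' ys'] dp qe pe False
      by (auto simp: doubleton_eq_iff split: if_splits)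
  qed
  then show False using contra x by blast
qed

text \<open>A total successor function lets the path neighbours of a set \<open>T\<close> be covered
  by two images of \<open>T\<close>, one taken from \<open>p\<close> and one from
  \<open>rev p\<close>.\<close>

lemma distinct_successor:
  assumes "distinct p"
  shows "\<exists>f. \<forall>xs a b ys. p = xs @ a # b # ys \<longrightarrow> f a = b"
proof -
  have "b = b'" if "p = xs @ a # b # ys" "p = xs' @ a # b' # ys'" for xs a b ys xs' b' ys'
  proof -
    have "distinct (xs @ a # b # ys)" using that(1) assms by blast
    then have "a \<notin> set xs" "a \<notin> set (b # ys)" by auto
    then have "b # ys = b' # ys'"
      using append_Cons_eq_iff[of a xs "b # ys" xs' "b' # ys'"] that by metis
    then show ?thesis by simp
  qed
  then have "\<exists>b. \<forall>xs b' ys. p = xs @ a # b' # ys \<longrightarrow> b = b'" for a by metis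
  then show ?thesis by metis
qed

section \<open>Expanders, connectivity and the effect of a booster\<close>

text \<open>The strict factor 2 is what contradicts the bound \<open>2 * card T\<close> on the
  neighbourhood of the set \<open>T\<close> of ends.\<close>

definition expander :: "'a set \<Rightarrow> nat \<Rightarrow> 'a set set \<Rightarrow> bool" where
  "expander V k E \<longleftrightarrow> E \<subseteq> pairs V \<and>
     (\<forall>T\<subseteq>V. T \<noteq> {} \<longrightarrow> card T \<le> k \<longrightarrow> 2 * card T < card (nbhd E T))"

definition partners :: "'a set \<Rightarrow> 'a set set \<Rightarrow> 'a \<Rightarrow> 'a set" where
  "partners V E v = {w. \<exists>p. longest V E p \<and> hd p = v \<and> last p = w}"

text \<open>Intersecting with \<open>pairs V\<close> discards the singleton that arises when a
  longest path consists of one vertex.\<close>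

definition boosters :: "'a set \<Rightarrow> 'a set set \<Rightarrow> 'a set set" where
  "boosters V E = {{v, w} | v w. w \<in> partners V E v} \<inter> pairs V"

lemma partners_sym: "w \<in> partners V E v \<longleftrightarrow> v \<in> partners V E w"
proof -
  have "v \<in> partners V E w" if w: "w \<in> partners V E v" for v w
  proof -
    obtain p where "longest V E p" "hd p = v" "last p = w" using w unfolding partners_def by blast
    then have "longest V E (rev p) \<and> hd (rev p) = w \<and> last (rev p) = v"
      using longest_rev by (auto simp: hd_rev last_rev)
    then show ?thesis unfolding partners_def by blast
  qed
  then show ?thesis by blast
qed

text \<open>Let \<open>T\<close> be the set of ends reached by rotations. By
  \<open>posa_neighbour\<close> every vertex of its external neighbourhood precedes or follows a
  member of \<open>T\<close> on \<open>p\<close>, so there are at most \<open>2 * card T\<close> of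
  them. Expansion then forces \<open>card T > k\<close>.\<close>

lemma posa:
  assumes V: "finite V" and E: "expander V k E" and p: "longest V E p"
  shows "k < card (partners V E (hd p))"
proof -
  define T where "T = {last q | q. rots E p q}"
  have pp: "is_path E p" "set p \<subseteq> V" using p unfolding longest_def by simp_all
  have ends: "last q \<in> set p" if "rots E p q" for q
    using rots_path[OF that pp(1)] unfolding is_path_def by (metis last_in_set)
  have TV: "T \<subseteq> V" "T \<noteq> {}" unfolding T_def using ends pp rots.base by blast+
  have fT: "finite T" using TV V finite_subset by blast
  have "longest V E q" if "rots E p q" for q
    using longest_same[OF p] rots_path[OF that pp(1)] by blast
  then have sub: "T \<subseteq> partners V E (hd p)"
    unfolding T_def partners_def using rots_path pp(1) by fast
  have "partners V E (hd p) \<subseteq> V"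
    unfolding partners_def longest_def is_path_def by (auto dest: last_in_set)
  then have le: "card T \<le> card (partners V E (hd p))"
    using sub V by (meson card_mono finite_subset)
  obtain f where f: "\<And>xs a b ys. p = xs @ a # b # ys \<Longrightarrow> f a = b"
    using distinct_successor pp(1) unfolding is_path_def by metis
  obtain g where g: "\<And>xs a b ys. rev p = xs @ a # b # ys \<Longrightarrow> g a = b"
    using distinct_successor[of "rev p"] pp(1) unfolding is_path_def by (metis distinct_rev)
  have EV: "E \<subseteq> pairs V" using E expander_def by blast
  have "nbhd E T \<subseteq> f ` T \<union> g ` T"
  proof
    fix w assume "w \<in> nbhd E T"
    then obtain q where q: "rots E p q" "w \<in> nbrs E (last q)" "w \<notin> T"
      unfolding nbhd_def T_def by blast
    moreover have "w \<in> V" "w \<noteq> last q" using nbrs_subset[OF EV] q(2) by blast+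
    ultimately obtain q' where q': "rots E p q'" "{w, last q'} \<in> steps p"
      using posa_neighbour[OF p q(1), of w] unfolding nbrs_def T_def by blast
    from q'(2) obtain a b xs ys where ab: "{w, last q'} = {a, b}" "p = xs @ a # b # ys"
      unfolding steps_def by blast
    have "rev p = rev ys @ b # a # rev xs" using ab(2) by simp
    then have "f a = b" "g b = a" using f g ab(2) by blast+
    then have "w = f (last q') \<or> w = g (last q')" using ab(1) by (auto simp: doubleton_eq_iff)
    then show "w \<in> f ` T \<union> g ` T" unfolding T_def using q'(1) by blast
  qed
  then have "card (nbhd E T) \<le> card (f ` T \<union> g ` T)" using fT by (simp add: card_mono)
  also have "\<dots> \<le> card T + card T"
    by (meson add_mono card_Un_le card_image_le fT order_trans)
  finally have "\<not> card T \<le> k" using E TV unfolding expander_def by (metis mult_2 not_le)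
  then show ?thesis using le by simp
qed

text \<open>Suppose no edge leaves \<open>S\<close>, where \<open>S\<close> has at most half of the
  vertices. A subset \<open>T\<close> of size \<open>min k (card S)\<close> has its neighbourhood
  inside \<open>S\<close>, so \<open>3 * card T < card S\<close>. Then \<open>card T = k\<close>,
  while \<open>card S < 3 * k\<close> by the choice of \<open>k\<close>. Larger sets are handled
  through their complement.\<close>

lemma expander_connected:
  assumes V: "finite V" and E: "expander V k E" and k: "card V < 6 * k"
    and S: "S \<subseteq> V" "S \<noteq> {}" "S \<noteq> V"
  shows "\<exists>x\<in>S. \<exists>y\<in>V - S. {x, y} \<in> E"
proof -
  have EV: "E \<subseteq> pairs V" using E expander_def by blast
  have main: "\<exists>x\<in>S. \<exists>y\<in>V - S. {x, y} \<in> E"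
    if S: "S \<subseteq> V" "S \<noteq> {}" "2 * card S \<le> card V" for S
  proof (rule ccontr)
    assume "\<not> ?thesis"
    then have no: "\<And>x y. x \<in> S \<Longrightarrow> y \<in> V \<Longrightarrow> {x, y} \<in> E \<Longrightarrow> y \<in> S" by blast
    have fS: "finite S" using S V finite_subset by blast
    obtain T where T: "T \<subseteq> S" "card T = min k (card S)"
      by (rule obtain_subset_with_card_n[of "min k (card S)" S]) simp
    have "k > 0" using k by simp
    have "card S > 0" using S fS by (simp add: card_gt_0_iff)
    have T0: "T \<noteq> {}" using T \<open>k > 0\<close> \<open>card S > 0\<close> by auto
    have "nbhd E T \<subseteq> S - T"
    proof
      fix w assume "w \<in> nbhd E T"
      then obtain x where x: "x \<in> T" "{x, w} \<in> E" "w \<notin> T" unfolding nbhd_def nbrs_def by blast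
      then have "w \<in> V" using EV by (meson pair_in_pairs subsetD)
      then show "w \<in> S - T" using no[of x w] x T(1) by blast
    qed
    then have "card (nbhd E T) \<le> card S - card T"
      using T fS by (metis card_Diff_subset card_mono finite_Diff finite_subset)
    moreover have "2 * card T < card (nbhd E T)"
    proof -
      have "T \<subseteq> V" "card T \<le> k" using T S by auto
      then show ?thesis using E T0 unfolding expander_def by blast
    qed
    ultimately have "3 * card T < card S" by simp
    then have "card T = k" using T by auto
    then show False using \<open>3 * card T < card S\<close> S k by simp
  qed
  show ?thesis
  proof (cases "2 * card S \<le> card V")
    case True then show ?thesis using main S by blast
  next
    case False
    have "card (V - S) = card V - card S" using S V by (simp add: card_Diff_subset finite_subset)
    then have "2 * card (V - S) \<le> card V" using False by simp
    moreover have "V - S \<noteq> {}" using S by blast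
    ultimately have "\<exists>x\<in>V - S. \<exists>y\<in>V - (V - S). {x, y} \<in> E" using main[of "V - S"] by blast
    then show ?thesis using S by (metis Diff_iff insert_commute)
  qed
qed

definition hamiltonian :: "'a set \<Rightarrow> 'a set set \<Rightarrow> bool" where
  "hamiltonian V E \<longleftrightarrow> (\<exists>vs. hamilton_cycle (UGraph V E) vs)"

lemma hamiltonian_mono: "hamiltonian V E \<Longrightarrow> E \<subseteq> E' \<Longrightarrow> hamiltonian V E'"
  unfolding hamiltonian_def hamilton_cycle_def ugraph.sel by blast

lemma hamiltonianI:
  assumes "is_path E p" "set p = V" "length p \<ge> 3" "{last p, hd p} \<in> E"
  shows "hamiltonian V E"
proof -
  have "{p ! i, p ! (Suc i mod length p)} \<in> E" if "i < length p" for i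
  proof (cases "Suc i < length p")
    case True
    then show ?thesis using assms(1) unfolding is_path_def by (simp add: successively_conv_nth)
  next
    case False
    then have "i = length p - 1" using that by simp
    moreover have "p \<noteq> []" using assms by auto
    ultimately show ?thesis using assms(4) by (simp add: last_conv_nth hd_conv_nth)
  qed
  then show ?thesis
    using assms unfolding hamiltonian_def hamilton_cycle_def is_path_def by auto
qed

lemma is_path_mono: "is_path E p \<Longrightarrow> E \<subseteq> E' \<Longrightarrow> is_path E' p"
  unfolding is_path_def by (metis (no_types, lifting) subsetD successively_mono)

text \<open>The booster closes some longest path \<open>q\<close> to a cycle. If \<open>q\<close>
  covers \<open>V\<close>, this is a Hamilton cycle; otherwise connectivity supplies an edge leaving
  the cycle, and opening the cycle there gives a path with one more vertex.\<close>

lemma booster_step: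
  assumes V: "finite V" and E: "expander V k E" and k: "card V < 6 * k" "k \<ge> 2"
    and e: "e \<in> boosters V E" and p: "longest V E p" and p': "longest V (insert e E) p'"
  shows "hamiltonian V (insert e E) \<or> length p < length p'"
proof -
  obtain v w where vw: "e = {v, w}" "w \<in> partners V E v" using e unfolding boosters_def by blast
  then obtain q where q: "longest V E q" "hd q = v" "last q = w" unfolding partners_def by blast
  have pq: "is_path E q" "set q \<subseteq> V" using q unfolding longest_def by simp_all
  have len: "length p = length q" using longest_length p q by blast
  have "partners V E (hd q) \<subseteq> V"
    unfolding partners_def longest_def is_path_def by (auto dest: last_in_set)
  have pq': "is_path (insert e E) q" using is_path_mono[OF pq(1)] by blast
  show ?thesis
  proof (cases "set q = V")
    case True
    \<comment> \<open>Since \<open>k \<ge> 2\<close>, this yields the three vertices that a Hamilton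
      cycle must have.\<close>
    have "k < card V"
      using posa[OF V E q(1)] card_mono[OF V \<open>partners V E (hd q) \<subseteq> V\<close>] by simp
    also have "card V = length q" using True pq unfolding is_path_def by (metis distinct_card)
    finally have "length q \<ge> 3" using k by simp
    then have "hamiltonian V (insert e E)"
      using hamiltonianI[OF pq' True] q vw by (simp add: insert_commute)
    then show ?thesis ..
  next
    case False
    moreover have "set q \<noteq> {}" using pq is_path_def by auto
    ultimately obtain x y where xy: "x \<in> set q" "y \<in> V" "y \<notin> set q" "{x, y} \<in> E"
      using expander_connected[OF V E k(1) pq(2)] by blast
    obtain xs ys where qe: "q = xs @ x # ys" using xy(1) by (meson split_list)
    \<comment> \<open>Enter the cycle at \<open>x\<close>, follow \<open>ys\<close> to the end of
      \<open>q\<close>, cross the booster to the start of \<open>q\<close>, and continue along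
      \<open>xs\<close>.\<close>
    have "is_path (insert e E) (y # x # ys @ xs)"
      using pq' xy q(2,3) vw(1) unfolding qe is_path_def
      by (cases "xs = []"; cases "ys = []")
        (auto simp: successively_append_iff successively_Cons insert_commute split: if_splits)
    moreover have "set (y # x # ys @ xs) \<subseteq> V" using pq(2) xy(2) qe by auto
    ultimately have "length (y # x # ys @ xs) \<le> length p'"
      using p' unfolding longest_def by blast
    then show ?thesis using len qe by simp
  qed
qed

section \<open>Resilience of pseudo-random graphs\<close>

lemma finite_subset_pairs: "finite V \<Longrightarrow> E \<subseteq> pairs V \<Longrightarrow> finite E"
  using finite_pairs finite_subset by blast

lemma finite_nbrs: "finite V \<Longrightarrow> E \<subseteq> pairs V \<Longrightarrow> finite (nbrs E v)"
  using nbrs_subset by (meson finite_Diff finite_subset)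

text \<open>Greedy choice: some point lies in at least a \<open>\<theta>\<close>-fraction of the sets not yet hit.\<close>

lemma hitting_set:
  fixes \<theta> :: real
  assumes E: "finite E" "E \<noteq> {}" and F: "finite F"
    and Q: "\<And>Q. Q \<in> F \<Longrightarrow> Q \<subseteq> E \<and> \<theta> * card E \<le> card Q" and \<theta>: "\<theta> \<le> 1"
  shows "\<exists>X\<subseteq>E. card X \<le> M \<and> card {Q \<in> F. X \<inter> Q = {}} \<le> (1 - \<theta>) ^ M * card F"
proof (induction M)
  case 0
  show ?case by (rule exI[of _ "{}"]) simp
next
  case (Suc M)
  then obtain X where X: "X \<subseteq> E" "card X \<le> M"
    "card {Q \<in> F. X \<inter> Q = {}} \<le> (1 - \<theta>) ^ M * card F" by blast
  define U where "U = {Q \<in> F. X \<inter> Q = {}}"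
  have fU: "finite U" using F unfolding U_def by simp
  \<comment> \<open>Averaging: incidences between edges and unhit sets are counted in both
    orders.\<close>
  have "\<exists>e\<in>E. \<theta> * card U \<le> card {Q \<in> U. e \<in> Q}"
  proof (rule ccontr)
    assume "\<not> ?thesis"
    then have "(\<Sum>e\<in>E. real (card {Q \<in> U. e \<in> Q})) < (\<Sum>e\<in>E. \<theta> * card U)"
      using E by (intro sum_strict_mono) (auto simp: not_le)
    also have "\<dots> = (\<Sum>Q\<in>U. \<theta> * card E)" by simp
    also have "\<dots> \<le> (\<Sum>Q\<in>U. real (card Q))"
      using Q by (intro sum_mono) (auto simp: U_def)
    also have "\<dots> = (\<Sum>Q\<in>U. \<Sum>e\<in>E. if e \<in> Q then 1 else 0)"
    proof (intro sum.cong refl)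
      fix S assume "S \<in> U"
      then have "S \<subseteq> E" using Q unfolding U_def by blast
      then have "E \<inter> {e. e \<in> S} = S" by blast
      then show "real (card S) = (\<Sum>e\<in>E. if e \<in> S then 1 else 0)"
        using E by (simp add: sum.If_cases)
    qed
    also have "\<dots> = (\<Sum>e\<in>E. \<Sum>Q\<in>U. if e \<in> Q then 1 else 0)" by (rule sum.swap)
    also have "\<dots> = (\<Sum>e\<in>E. real (card {Q \<in> U. e \<in> Q}))"
      using fU by (intro sum.cong refl) (simp add: sum.If_cases Int_def)
    finally show False by simp
  qed
  then obtain e where e: "e \<in> E" "\<theta> * card U \<le> card {Q \<in> U. e \<in> Q}" by blast
  have eq: "{Q \<in> F. insert e X \<inter> Q = {}} = U - {Q \<in> U. e \<in> Q}" unfolding U_def by auto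
  have "real (card {Q \<in> F. insert e X \<inter> Q = {}}) = real (card U) - real (card {Q \<in> U. e \<in> Q})"
    unfolding eq using fU by (subst card_Diff_subset) (auto intro!: of_nat_diff card_mono)
  also have "\<dots> \<le> (1 - \<theta>) * card U" using e by (simp add: algebra_simps)
  also have "\<dots> \<le> (1 - \<theta>) * ((1 - \<theta>) ^ M * card F)"
    using X(3) \<theta> unfolding U_def by (intro mult_left_mono) auto
  finally have "card {Q \<in> F. insert e X \<inter> Q = {}} \<le> (1 - \<theta>) ^ Suc M * card F" by simp
  moreover have "card (insert e X) \<le> Suc M"
    using X E finite_subset[OF X(1) E(1)] by (simp add: card_insert_if)
  ultimately show ?case using X e by (intro exI[of _ "insert e X"]) auto
qed

section \<open>Sparse skeletons meeting all dense cuts\<close>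

definition cross :: "'a set \<Rightarrow> 'a set \<Rightarrow> 'a set set" where
  "cross A B = {{a, b} | a b. a \<in> A \<and> b \<in> B}"

lemma card_cross_le:
  fixes c :: real
  assumes "finite V" "T \<subseteq> V" "H \<subseteq> pairs V" "\<And>t. t \<in> V \<Longrightarrow> real (card (nbrs H t)) \<le> c"
  shows "card (H \<inter> cross T W) \<le> real (card T) * c"
proof -
  have fH: "finite H" and fT: "finite T"
    using assms finite_subset_pairs finite_subset by blast+
  have "H \<inter> cross T W \<subseteq> (\<Union>t\<in>T. {e \<in> H. t \<in> e})" unfolding cross_def by auto
  then have "card (H \<inter> cross T W) \<le> card (\<Union>t\<in>T. {e \<in> H. t \<in> e})"
    using fH fT by (intro card_mono) auto
  also have "\<dots> \<le> (\<Sum>t\<in>T. card {e \<in> H. t \<in> e})" using fT by (rule card_UN_le)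
  finally have "real (card (H \<inter> cross T W)) \<le> (\<Sum>t\<in>T. real (card {e \<in> H. t \<in> e}))"
    by (metis of_nat_le_iff of_nat_sum)
  also have "\<dots> \<le> (\<Sum>t\<in>T. c)"
    using assms(2,4) unfolding card_nbrs[OF assms(3)] by (intro sum_mono) blast
  finally show ?thesis by simp
qed

text \<open>The union of \<open>D\<close> edges chosen at each vertex and a greedy hitting set for
  all cuts with at least \<open>q\<close> edges. There are at most \<open>4 ^ card V\<close> cuts,
  each containing at least a \<open>q / N\<close> fraction of \<open>E\<close>, so after
  \<open>M\<close> rounds fewer than one remains unhit.\<close>

lemma skeleton:
  fixes q N :: real
  assumes V: "finite V" and E: "E \<subseteq> pairs V" and deg: "\<And>v. v \<in> V \<Longrightarrow> D \<le> card (nbrs E v)"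
    and q: "0 < q" "q \<le> N" "card E \<le> N" and M: "4 ^ card V * (1 - q / N) ^ M < 1"
  shows "\<exists>\<Gamma>\<subseteq>E. card \<Gamma> \<le> card V * D + M \<and> (\<forall>v\<in>V. D \<le> card (nbrs \<Gamma> v)) \<and>
    (\<forall>A\<subseteq>V. \<forall>B\<subseteq>V. q \<le> card (E \<inter> cross A B) \<longrightarrow> \<Gamma> \<inter> cross A B \<noteq> {})"
proof -
  have fE: "finite E" using finite_subset_pairs V E by blast
  have "\<exists>S\<subseteq>nbrs E v. card S = D" if "v \<in> V" for v
    using obtain_subset_with_card_n[OF deg[OF that]] by metis
  then obtain S where S: "\<And>v. v \<in> V \<Longrightarrow> S v \<subseteq> nbrs E v \<and> card (S v) = D" by metis
  define X1 where "X1 = (\<Union>v\<in>V. (\<lambda>w. {v, w}) ` S v)"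
  have fS: "finite (S v)" if "v \<in> V" for v
    using S[OF that] finite_nbrs[OF V E] finite_subset by blast
  have X1E: "X1 \<subseteq> E" using S unfolding X1_def nbrs_def by blast
  have "card X1 \<le> (\<Sum>v\<in>V. card ((\<lambda>w. {v, w}) ` S v))"
    unfolding X1_def by (rule card_UN_le[OF V])
  also have "\<dots> \<le> (\<Sum>v\<in>V. D)"
    using S fS by (intro sum_mono) (metis card_image_le)
  finally have cX1: "card X1 \<le> card V * D" by simp
  have dX1: "D \<le> card (nbrs X1 v)" if v: "v \<in> V" for v
  proof -
    have "S v \<subseteq> nbrs X1 v" unfolding nbrs_def X1_def using v by blast
    then have "card (S v) \<le> card (nbrs X1 v)"
      using finite_nbrs[OF V, of X1] X1E E by (meson card_mono subset_trans)
    then show ?thesis using S[OF v] by simp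
  qed
  have "\<exists>X\<subseteq>E. card X \<le> M \<and>
      (\<forall>A\<subseteq>V. \<forall>B\<subseteq>V. q \<le> card (E \<inter> cross A B) \<longrightarrow> X \<inter> cross A B \<noteq> {})"
  proof (cases "E = {}")
    case True
    then show ?thesis using q by auto
  next
    case False
    define F where "F = (\<lambda>(A, B). E \<inter> cross A B) ` (Pow V \<times> Pow V) \<inter> {Q. q \<le> card Q}"
    have fF: "finite F" unfolding F_def using V by auto
    have "card F \<le> card ((\<lambda>(A, B). E \<inter> cross A B) ` (Pow V \<times> Pow V))"
      unfolding F_def using V by (intro card_mono) auto
    also have "\<dots> \<le> card (Pow V \<times> Pow V)" using V by (intro card_image_le) auto
    also have "\<dots> = 4 ^ card V"
      using V by (simp add: card_cartesian_product card_Pow flip: power_mult_distrib)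
    finally have cF: "real (card F) \<le> 4 ^ card V"
      by (metis of_nat_le_iff of_nat_numeral of_nat_power)
    have "q / N * card E \<le> q" using q by (simp add: field_simps mult_left_mono)
    then have FQ: "Q \<subseteq> E \<and> q / N * card E \<le> card Q" if "Q \<in> F" for Q
      using that unfolding F_def by auto
    have qN: "q / N \<le> 1" using q by simp
    obtain X where X: "X \<subseteq> E" "card X \<le> M" "card {Q \<in> F. X \<inter> Q = {}} \<le> (1 - q / N) ^ M * card F"
      using hitting_set[OF fE False fF FQ qN, of M] by blast
    have "(1 - q / N) ^ M * card F \<le> (1 - q / N) ^ M * 4 ^ card V"
      using cF qN by (intro mult_left_mono) auto
    then have "real (card {Q \<in> F. X \<inter> Q = {}}) < 1" using X(3) M by (simp add: mult.commute)
    then have no: "{Q \<in> F. X \<inter> Q = {}} = {}" using fF by simp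
    have "X \<inter> cross A B \<noteq> {}" if "A \<subseteq> V" "B \<subseteq> V" "q \<le> card (E \<inter> cross A B)" for A B
    proof -
      have "E \<inter> cross A B \<in> F" unfolding F_def using that by blast
      then show ?thesis using no X(1) by blast
    qed
    then show ?thesis using X by blast
  qed
  then obtain X2 where X2: "X2 \<subseteq> E" "card X2 \<le> M"
    "\<And>A B. A \<subseteq> V \<Longrightarrow> B \<subseteq> V \<Longrightarrow> q \<le> card (E \<inter> cross A B) \<Longrightarrow> X2 \<inter> cross A B \<noteq> {}" by metis
  have "D \<le> card (nbrs (X1 \<union> X2) v)" if "v \<in> V" for v
  proof -
    have "card (nbrs X1 v) \<le> card (nbrs (X1 \<union> X2) v)"
      using X1E X2(1) E by (intro card_mono finite_nbrs[OF V] nbrs_mono) auto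
    then show ?thesis using dX1[OF that] by simp
  qed
  moreover have "card (X1 \<union> X2) \<le> card V * D + M"
    using card_Un_le[of X1 X2] cX1 X2(2) by linarith
  moreover have "(X1 \<union> X2) \<inter> cross A B \<noteq> {}"
    if "A \<subseteq> V" "B \<subseteq> V" "q \<le> card (E \<inter> cross A B)" for A B
    using X2(3)[OF that] by blast
  ultimately show ?thesis using X1E X2(1) by (intro exI[of _ "X1 \<union> X2"]) blast
qed

section \<open>Typical graphs: expansion of the skeleton and survival of boosters\<close>

text \<open>Three properties at edge density \<open>d / card V\<close>: small sets are sparse,
  disjoint sets have nearly the expected number of edges between them, and the boosters of every
  sparse subgraph of the graph itself are nearly as frequent as expected. The last two are lower
  bounds with an additive error.\<close>

definition typical :: "'a set \<Rightarrow> nat \<Rightarrow> nat \<Rightarrow> real \<Rightarrow> real \<Rightarrow> 'a set set \<Rightarrow> bool" where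
  "typical V d s \<alpha> \<kappa> E \<longleftrightarrow>
     (\<forall>U\<subseteq>V. real (card U) \<le> 3 * \<alpha> * real (card V) \<longrightarrow> card (E \<inter> pairs U) \<le> s * card U) \<and>
     (\<forall>A\<subseteq>V. \<forall>B\<subseteq>V. A \<inter> B = {} \<longrightarrow>
        real (card A) * real (card B) * real d / real (card V) - \<alpha> / 50 * (real (card V) * real d)
          \<le> real (card (E \<inter> cross A B))) \<and>
     (\<forall>\<Gamma>\<subseteq>E. real (card \<Gamma>) \<le> \<kappa> * (real (card V) * real d) \<longrightarrow>
        real (card (boosters V \<Gamma>)) * real d / real (card V) - real (card V) * real d / 100
          \<le> real (card (E \<inter> boosters V \<Gamma>)))"

lemma typical_boosters:
  assumes "typical V d s \<alpha> \<kappa> E" "\<Gamma> \<subseteq> E" "real (card \<Gamma>) \<le> \<kappa> * (real (card V) * real d)"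
  shows "real (card (boosters V \<Gamma>)) * real d / real (card V) - real (card V) * real d / 100
    \<le> real (card (E \<inter> boosters V \<Gamma>))"
  using assms unfolding typical_def by blast

text \<open>All edges at \<open>T\<close> lie inside the set formed by \<open>T\<close> and its
  neighbourhood, where degrees sum to twice the number of edges.\<close>

lemma cross_sum_nbrs:
  assumes V: "finite V" and E: "E \<subseteq> pairs V" and T: "T \<subseteq> V"
  shows "(\<Sum>t\<in>T. card (nbrs E t)) \<le> 2 * card (E \<inter> pairs (T \<union> nbhd E T))"
proof -
  let ?U = "T \<union> nbhd E T" and ?E' = "E \<inter> pairs (T \<union> nbhd E T)"
  have UV: "?U \<subseteq> V" unfolding nbhd_def using T nbrs_subset[OF E] by blast
  then have fU: "finite ?U" using V finite_subset by blast
  have sub: "nbrs E t \<subseteq> nbrs ?E' t" if "t \<in> T" for t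
  proof
    fix w assume w: "w \<in> nbrs E t"
    then have "w \<in> ?U" "w \<noteq> t" unfolding nbhd_def using that nbrs_subset[OF E] by blast+
    then show "w \<in> nbrs ?E' t" using w that unfolding nbrs_def by simp
  qed
  have "(\<Sum>t\<in>T. card (nbrs E t)) \<le> (\<Sum>t\<in>T. card (nbrs ?E' t))"
    using sub E by (intro sum_mono card_mono finite_nbrs[OF V]) auto
  also have "\<dots> \<le> (\<Sum>t\<in>?U. card (nbrs ?E' t))" using fU by (intro sum_mono2) auto
  also have "\<dots> = 2 * card ?E'" using sum_card_nbrs[OF fU, of ?E'] by simp
  finally show ?thesis .
qed

text \<open>A set \<open>T\<close> violating expansion yields \<open>U\<close> with
  \<open>card U \<le> 3 * card T\<close> that captures all edges of \<Gamma> at \<open>T\<close>. If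
  \<open>U\<close> is small, this contradicts local sparsity; if it is large, it contradicts the
  density of cuts.\<close>

lemma skeleton_expander:
  fixes V :: "'a set"
  assumes V: "finite V" "V \<noteq> {}" and d: "d > 0" and s: "s > 0" and \<alpha>: "\<alpha> > 0" and E: "E \<subseteq> pairs V"
    and typ_E: "typical V d s \<alpha> \<kappa> E" and H: "H \<subseteq> E" "\<And>v. v \<in> V \<Longrightarrow> real (card (nbrs H v)) \<le> real d / 6"
    and \<Gamma>: "\<Gamma> \<subseteq> E - H" "\<And>v. v \<in> V \<Longrightarrow> 7 * s \<le> card (nbrs \<Gamma> v)"
    and hit: "\<And>A B. A \<subseteq> V \<Longrightarrow> B \<subseteq> V \<Longrightarrow> \<alpha> / 50 * (real (card V) * real d) \<le> card ((E - H) \<inter> cross A B) \<Longrightarrow>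
        \<Gamma> \<inter> cross A B \<noteq> {}"
  shows "expander V (card V div 4) \<Gamma>"
  unfolding expander_def
proof (intro conjI allI impI)
  show \<Gamma>V: "\<Gamma> \<subseteq> pairs V" using \<Gamma> E by blast
  fix T assume T: "T \<subseteq> V" "T \<noteq> {}" "card T \<le> card V div 4"
  show "2 * card T < card (nbhd \<Gamma> T)"
  proof (rule ccontr)
    assume small: "\<not> ?thesis"
    define U where "U = T \<union> nbhd \<Gamma> T"
    have UV: "U \<subseteq> V" unfolding U_def nbhd_def using T nbrs_subset[OF \<Gamma>V] by blast
    have fin: "finite T" "finite U" using T UV V finite_subset by blast+
    have "card U \<le> card T + card (nbhd \<Gamma> T)" unfolding U_def by (rule card_Un_le)
    then have U3: "card U \<le> 3 * card T" using small by simp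
    have T0: "card T > 0" using T fin by (simp add: card_gt_0_iff)
    show False
    proof (cases "real (card U) \<le> 3 * \<alpha> * card V")
      case True
      \<comment> \<open>The chain reads
        \<open>7 * s * card T \<le> 2 * s * card U \<le> 6 * s * card T\<close>, which fails because
        \<open>T\<close> and \<open>s\<close> are nonzero.\<close>
      have "card T * (7 * s) \<le> (\<Sum>t\<in>T. card (nbrs \<Gamma> t))"
        using \<Gamma>(2) T by (intro sum_bounded_below[of T "7 * s", simplified]) auto
      also have "\<dots> \<le> 2 * card (\<Gamma> \<inter> pairs U)"
        unfolding U_def by (rule cross_sum_nbrs[OF V(1) \<Gamma>V T(1)])
      also have "\<dots> \<le> 2 * card (E \<inter> pairs U)"
        using \<Gamma> finite_subset_pairs[OF V(1) E] by (intro mult_left_mono card_mono) auto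
      also have "\<dots> \<le> 2 * (s * card U)"
        using typ_E True UV unfolding typical_def by (intro mult_left_mono) blast+
      also have "\<dots> \<le> 6 * s * card T" using U3 by simp
      finally show False using T0 s by simp
    next
      case False
      \<comment> \<open>No edge of \<Gamma> joins \<open>T\<close> to \<open>W\<close>, so
        \<open>hit\<close> leaves few edges of \<open>E - H\<close> there. As \<open>W\<close> has
        at least a quarter of the vertices, \<open>E\<close> has nearly
        \<open>card T * d / 4\<close> such edges, of which \<open>H\<close> takes at most
        \<open>card T * d / 6\<close>. The difference \<open>card T * d / 12\<close> must be below
        the two error terms, although \<open>card T\<close> exceeds
        \<open>\<alpha> * card V\<close>.\<close>
      define W where "W = V - U"
      have "\<Gamma> \<inter> cross T W = {}"
        unfolding cross_def W_def U_def nbhd_def nbrs_def using T by fastforce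
      then have "real (card ((E - H) \<inter> cross T W)) < \<alpha> / 50 * (real (card V) * real d)"
        using hit[of T W] T unfolding W_def by fastforce
      moreover have "real (card (H \<inter> cross T W)) \<le> card T * (real d / 6)"
        using card_cross_le[OF V(1) T(1), of H "real d / 6" W] H E by blast
      moreover have "card (E \<inter> cross T W) \<le> card ((E - H) \<inter> cross T W) + card (H \<inter> cross T W)"
      proof -
        have "E \<inter> cross T W = ((E - H) \<inter> cross T W) \<union> (H \<inter> cross T W)" using H by blast
        then show ?thesis by (metis card_Un_le)
      qed
      then have "real (card (E \<inter> cross T W)) \<le> real (card ((E - H) \<inter> cross T W)) + card (H \<inter> cross T W)"
        by (metis of_nat_add of_nat_le_iff)
      moreover have "W \<subseteq> V" "T \<inter> W = {}" unfolding W_def U_def by auto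
      then have "real (card T) * card W * d / card V - \<alpha> / 50 * (real (card V) * real d) \<le> card (E \<inter> cross T W)"
        using typ_E T unfolding typical_def by blast
      moreover have "card T * (real d / 4) \<le> real (card T) * card W * d / card V"
      proof -
        have "card W = card V - card U" unfolding W_def using fin UV by (simp add: card_Diff_subset)
        then have "card V \<le> 4 * card W" using U3 T(3) by linarith
        then have "real (card V) \<le> 4 * real (card W)" by linarith
        then have "real (card T) * d * card V \<le> real (card T) * d * (4 * card W)"
          by (intro mult_left_mono) auto
        moreover have "card V > 0" using V by (simp add: card_gt_0_iff)
        ultimately show ?thesis by (simp add: field_simps)
      qed
      ultimately have "card T * (real d / 4) < card T * (real d / 6) + \<alpha> / 25 * (real (card V) * real d)" by linarith
      then have "(card T / 12) * real d < (\<alpha> / 25 * card V) * real d" by (simp add: field_simps)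
      then have "card T / 12 < \<alpha> / 25 * card V" using d by (simp add: mult_less_cancel_right)
      moreover have "\<alpha> * card V < card T" using False U3 by linarith
      moreover have "0 \<le> \<alpha> * card V" using \<alpha> by simp
      ultimately show False by linarith
    qed
  qed
qed

lemma boosters_subset: "boosters V E \<subseteq> pairs V"
  unfolding boosters_def by blast

lemma partners_subset: "partners V E v \<subseteq> V"
  unfolding partners_def longest_def is_path_def by (auto dest: last_in_set)

lemma nbrs_boosters:
  assumes "v \<in> V"
  shows "nbrs (boosters V E) v = partners V E v - {v}"
proof (intro equalityI subsetI)
  fix w assume "w \<in> nbrs (boosters V E) v"
  then obtain a b where "{v, w} = {a, b}" "b \<in> partners V E a" "v \<noteq> w"
    unfolding nbrs_def boosters_def by auto
  then show "w \<in> partners V E v - {v}"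
    using partners_sym[of b V E a] by (auto simp: doubleton_eq_iff)
next
  fix w assume "w \<in> partners V E v - {v}"
  then show "w \<in> nbrs (boosters V E) v"
    using partners_subset[of V E v] assms unfolding nbrs_def boosters_def by auto
qed

text \<open>Let \<open>S\<close> be the set of ends of longest paths. It has more than a quarter of
  the vertices, and each member has more than \<open>card V div 4\<close> partners. Doubled counts
  then compare about \<open>card S * d / 4\<close> boosters in \<open>E\<close> with at most
  \<open>card S * d / 6\<close> in \<open>H\<close>.\<close>

lemma booster_exists:
  assumes V: "finite V" "card V \<ge> 400" and d: "d > 0" and E: "E \<subseteq> pairs V"
    and typ_E: "typical V d s \<alpha> \<kappa> E" and H: "H \<subseteq> E" "\<And>v. v \<in> V \<Longrightarrow> real (card (nbrs H v)) \<le> real d / 6"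
    and \<Gamma>: "\<Gamma> \<subseteq> E - H" "card \<Gamma> \<le> \<kappa> * (real (card V) * real d)" "expander V (card V div 4) \<Gamma>"
  shows "\<exists>e\<in>boosters V \<Gamma>. e \<in> E - H"
proof (rule ccontr)
  assume none: "\<not> ?thesis"
  define B where "B = boosters V \<Gamma>"
  define S where "S = {v \<in> V. partners V \<Gamma> v \<noteq> {}}"
  have BV: "B \<subseteq> pairs V" unfolding B_def by (rule boosters_subset)
  have fS: "finite S" "S \<subseteq> V" unfolding S_def using V by auto
  have big: "card V div 4 < card (partners V \<Gamma> v)" if "v \<in> S" for v
    using that posa[OF V(1) \<Gamma>(3)] unfolding S_def partners_def by blast
  have "V \<noteq> {}" using V by auto
  then obtain p where p: "longest V \<Gamma> p" using longest_exists V by blast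
  then have "hd p \<in> S"
    unfolding S_def partners_def longest_def is_path_def by (auto simp: hd_in_set subsetD)
  then have "card V div 4 < card (partners V \<Gamma> (hd p))" by (rule big)
  also have "\<dots> \<le> card S"
  proof (rule card_mono[OF fS(1)], rule subsetI)
    fix w assume "w \<in> partners V \<Gamma> (hd p)"
    then have "hd p \<in> partners V \<Gamma> w" "w \<in> V" using partners_sym[of w V \<Gamma> "hd p"] partners_subset[of V \<Gamma> "hd p"] by blast+
    then show "w \<in> S" unfolding S_def by blast
  qed
  finally have "card V < 4 * card S" by linarith
  then have cS: "real (card V) / 4 \<le> card S" by linarith
  have nB: "nbrs B v = (if v \<in> S then partners V \<Gamma> v - {v} else {})" if "v \<in> V" for v
    using nbrs_boosters[OF that, of \<Gamma>] that unfolding B_def S_def by auto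
  have "(\<Sum>v\<in>S. card V / 4 - 1) \<le> (\<Sum>v\<in>S. real (card (nbrs B v)))"
  proof (rule sum_mono)
    fix v assume v: "v \<in> S"
    have "card (partners V \<Gamma> v) \<le> card (nbrs B v) + 1"
    proof -
      have "nbrs B v = partners V \<Gamma> v - {v}" using nB v fS by auto
      then show ?thesis
        by (simp add: card_Diff_singleton_if) linarith
    qed
    then have "card V div 4 \<le> card (nbrs B v)" using big[OF v] by linarith
    then show "card V / 4 - 1 \<le> real (card (nbrs B v))" by linarith
  qed
  also have "\<dots> = (\<Sum>v\<in>V. real (card (nbrs B v)))"
    using nB V fS by (intro sum.mono_neutral_left) auto
  also have "\<dots> = 2 * card B" using sum_card_nbrs[OF V(1) BV] by (metis of_nat_mult of_nat_numeral of_nat_sum)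
  finally have cB: "card S * (card V / 4 - 1) \<le> 2 * real (card B)" by simp
  have HV: "H \<inter> B \<subseteq> pairs V" using BV by blast
  \<comment> \<open>Both vertices of a booster lie in \<open>S\<close>, so \<open>H\<close> is
    charged for the vertices of \<open>S\<close> only.\<close>
  have "2 * real (card (H \<inter> B)) = (\<Sum>v\<in>V. real (card (nbrs (H \<inter> B) v)))"
    using sum_card_nbrs[OF V(1) HV] by (metis of_nat_mult of_nat_numeral of_nat_sum)
  also have "\<dots> = (\<Sum>v\<in>S. real (card (nbrs (H \<inter> B) v)))"
  proof (intro sum.mono_neutral_right V fS ballI)
    fix v assume "v \<in> V - S"
    then have "nbrs B v = {}" using nB by auto
    then have "nbrs (H \<inter> B) v = {}" using nbrs_mono[of "H \<inter> B" B v] by blast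
    then show "real (card (nbrs (H \<inter> B) v)) = 0" by simp
  qed
  also have "\<dots> \<le> (\<Sum>v\<in>S. real d / 6)"
  proof (rule sum_mono)
    fix v assume v: "v \<in> S"
    have "card (nbrs (H \<inter> B) v) \<le> card (nbrs H v)"
      using H E by (intro card_mono finite_nbrs[OF V(1)] nbrs_mono) auto
    then show "real (card (nbrs (H \<inter> B) v)) \<le> real d / 6" using H(2)[of v] v fS by fastforce
  qed
  finally have cH: "2 * real (card (H \<inter> B)) \<le> card S * (real d / 6)" by simp
  have "E \<inter> B = H \<inter> B" using none H unfolding B_def by blast
  moreover have "real (card B) * d / card V - real (card V) * real d / 100 \<le> card (E \<inter> B)"
    unfolding B_def using typical_boosters[OF typ_E _ \<Gamma>(2)] \<Gamma>(1) by blast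
  ultimately have "2 * card B * d / card V \<le> real (card V) * real d / 50 + card S * (real d / 6)"
    using cH by simp
  moreover have "card S * (card V / 4 - 1) * d / card V \<le> 2 * card B * d / card V"
    using mult_right_mono[OF cB, of "real d"] by (intro divide_right_mono) auto
  ultimately have "(card S * (card V / 4 - 1) / card V) * d \<le> (card V / 50 + card S / 6) * d"
    by (simp add: algebra_simps)
  then have "card S * (card V / 4 - 1) / card V \<le> card V / 50 + card S / 6"
    by (rule mult_right_le_imp_le) (use d in simp)
  moreover have "card S * (card V / 4 - 1) / card V = card S / 4 - card S / card V"
  proof -
    have "real (card V) \<noteq> 0" using V(2) by linarith
    then show ?thesis by (simp add: field_simps)
  qed
  moreover have "card S / card V \<le> card S * (1 / 400)"
    using V by (simp add: field_simps mult_left_mono)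
  ultimately have "real (card S) / 4 - card S * (1 / 400) \<le> card V / 50 + card S / 6" by linarith
  then have "card S * (1/12 - 1/400) \<le> card V / 50" by (simp add: algebra_simps)
  \<comment> \<open>The term \<open>1/12\<close> is \<open>1/4 - 1/6\<close>, the loss
    \<open>1/400\<close> comes from excluding a vertex as its own partner, and \<open>1/50\<close>
    is twice the error allowed by \<open>typical\<close>. The contradiction is
    \<open>(1/12 - 1/400) / 4 > 1/50\<close>.\<close>
  moreover have "card V / 4 * (1/12 - 1/400) \<le> card S * (1/12 - 1/400)"
    using cS by (intro mult_right_mono) auto
  ultimately have "card V / 4 * (1/12 - 1/400) \<le> card V / 50" by linarith
  then show False using V by simp
qed

lemma expander_mono:
  assumes "expander V k E" "E \<subseteq> E'" "E' \<subseteq> pairs V" "finite V"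
  shows "expander V k E'"
  unfolding expander_def
proof (intro conjI allI impI)
  fix T assume T: "T \<subseteq> V" "T \<noteq> {}" "card T \<le> k"
  have "nbhd E T \<subseteq> nbhd E' T" unfolding nbhd_def using nbrs_mono[OF assms(2)] by blast
  moreover have "nbhd E' T \<subseteq> V" unfolding nbhd_def using nbrs_subset[OF assms(3)] by blast
  then have "finite (nbhd E' T)" using assms(4) finite_subset by blast
  ultimately have "card (nbhd E T) \<le> card (nbhd E' T)" by (metis card_mono)
  moreover have "2 * card T < card (nbhd E T)" using assms(1) T unfolding expander_def by blast
  ultimately show "2 * card T < card (nbhd E' T)" by linarith
qed (rule assms)

text \<open>The sparsity budget in \<open>size\<close> pays for \<open>7 * s\<close> edges per
  vertex, \<open>M\<close> hitting edges and \<open>card V + 1\<close> boosters, so that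
  \<open>typical\<close> applies to every intermediate subgraph.\<close>

theorem typical_resilient:
  assumes V: "finite V" "card V \<ge> 400" and d: "d > 0" and s: "s > 0" "42 * s \<le> 5 * d"
    and \<alpha>: "\<alpha> > 0" "\<alpha> \<le> 1" and E: "E \<subseteq> pairs V" "\<And>v. v \<in> V \<Longrightarrow> card (nbrs E v) = d"
    and typ_E: "typical V d s \<alpha> \<kappa> E" and H: "H \<subseteq> E" "\<And>v. v \<in> V \<Longrightarrow> 6 * card (nbrs H v) \<le> d"
    and M: "4 ^ card V * (1 - \<alpha> / 25) ^ M < 1"
    and size: "card V * (7 * s) + M + card V + 1 \<le> \<kappa> * (real (card V) * real d)"
  shows "hamiltonian V (E - H)"
proof -
  let ?n = "card V"
  have n0: "?n > 0" "V \<noteq> {}" using V by auto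
  have fE: "finite E" using V E finite_subset_pairs by blast
  have H': "real (card (nbrs H v)) \<le> real d / 6" if "v \<in> V" for v using H(2)[OF that] by linarith
  \<comment> \<open>At least \<open>5 * d / 6\<close> edges remain at each vertex, which explains
    the condition \<open>42 * s \<le> 5 * d\<close>.\<close>
  have deg: "7 * s \<le> card (nbrs (E - H) v)" if v: "v \<in> V" for v
  proof -
    have "nbrs (E - H) v = nbrs E v - nbrs H v" unfolding nbrs_def by blast
    then have "d - card (nbrs H v) \<le> card (nbrs (E - H) v)"
      using E(2)[OF v] finite_nbrs[OF V(1), of H v] H(1) E(1) diff_card_le_card_Diff by (metis subset_trans)
    then show ?thesis using H(2)[OF v] s by linarith
  qed
  have cE: "real (card (E - H)) \<le> real ?n * real d / 2"
  proof -
    have "2 * card E = ?n * d" using sum_card_nbrs[OF V(1) E(1)] E(2) by simp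
    moreover have "card (E - H) \<le> card E" using fE by (intro card_mono) auto
    ultimately have "2 * card (E - H) \<le> ?n * d" by linarith
    then have "2 * real (card (E - H)) \<le> ?n * d" by (metis of_nat_le_iff of_nat_mult of_nat_numeral)
    then show ?thesis by simp
  qed
  have pos: "?n * real d > 0" using n0 d by simp
  \<comment> \<open>The cut threshold over the bound \<open>?n * d / 2\<close> on the number of
    edges: the fraction used by the hitting set.\<close>
  have "\<alpha> / 50 * (real ?n * real d) / (real ?n * real d / 2) = \<alpha> / 25" using n0 d by (simp add: field_simps)
  note ratio = this
  have M': "4 ^ ?n * (1 - \<alpha> / 50 * (real ?n * real d) / (real ?n * real d / 2)) ^ M < 1" unfolding ratio by (rule M)
  have q: "0 < \<alpha> / 50 * (real ?n * real d)" "\<alpha> / 50 * (real ?n * real d) \<le> real ?n * real d / 2"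
    using pos \<alpha> mult_right_mono[of "\<alpha> / 50" "1 / 2" "?n * real d"] by auto
  have EH: "E - H \<subseteq> pairs V" using E(1) by blast
  have "\<exists>\<Gamma>\<subseteq>E - H. card \<Gamma> \<le> ?n * (7 * s) + M \<and> (\<forall>v\<in>V. 7 * s \<le> card (nbrs \<Gamma> v)) \<and>
    (\<forall>A\<subseteq>V. \<forall>B\<subseteq>V. \<alpha> / 50 * (real ?n * real d) \<le> card ((E - H) \<inter> cross A B) \<longrightarrow>
      \<Gamma> \<inter> cross A B \<noteq> {})"
    by (rule skeleton[OF V(1) EH deg q cE M'])
  then obtain \<Gamma>\<^sub>0 where \<Gamma>\<^sub>0: "\<Gamma>\<^sub>0 \<subseteq> E - H" "card \<Gamma>\<^sub>0 \<le> ?n * (7 * s) + M"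
      "\<forall>v\<in>V. 7 * s \<le> card (nbrs \<Gamma>\<^sub>0 v)"
      "\<forall>A\<subseteq>V. \<forall>B\<subseteq>V. \<alpha> / 50 * (real ?n * real d) \<le> card ((E - H) \<inter> cross A B) \<longrightarrow>
        \<Gamma>\<^sub>0 \<inter> cross A B \<noteq> {}"
    by (elim exE conjE)
  have exp0: "expander V (?n div 4) \<Gamma>\<^sub>0"
    using skeleton_expander[OF V(1) n0(2) d s(1) \<alpha>(1) E(1) typ_E H(1) H' \<Gamma>\<^sub>0(1)]
      \<Gamma>\<^sub>0(3,4) by blast
  have k: "?n < 6 * (?n div 4)" "?n div 4 \<ge> 2" using V by linarith+
  \<comment> \<open>Each added booster gives a Hamilton cycle or lengthens the longest path. A path
    with \<open>?n + 1\<close> vertices cannot exist, so the case \<open>j = ?n + 1\<close> leaves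
    only the cycle.\<close>
  have "\<exists>\<Gamma>. \<Gamma>\<^sub>0 \<subseteq> \<Gamma> \<and> \<Gamma> \<subseteq> E - H \<and> card \<Gamma> \<le> card \<Gamma>\<^sub>0 + j \<and>
      (hamiltonian V \<Gamma> \<or> (\<exists>p. longest V \<Gamma> p \<and> j \<le> length p))" if "j \<le> ?n + 1" for j
    using that
  proof (induction j)
    case 0
    then show ?case using \<Gamma>\<^sub>0(1) longest_exists[OF V(1) n0(2)] by auto
  next
    case (Suc j)
    then obtain \<Gamma> where \<Gamma>: "\<Gamma>\<^sub>0 \<subseteq> \<Gamma>" "\<Gamma> \<subseteq> E - H" "card \<Gamma> \<le> card \<Gamma>\<^sub>0 + j"
      "hamiltonian V \<Gamma> \<or> (\<exists>p. longest V \<Gamma> p \<and> j \<le> length p)" by auto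
    show ?case
    proof (cases "hamiltonian V \<Gamma>")
      case True then show ?thesis using \<Gamma> by auto
    next
      case False
      then obtain p where p: "longest V \<Gamma> p" "j \<le> length p" using \<Gamma> by blast
      have ex: "expander V (?n div 4) \<Gamma>"
        using expander_mono[OF exp0 \<Gamma>(1)] \<Gamma>(2) E(1) V(1) by blast
      have "card \<Gamma> \<le> ?n * (7 * s) + M + ?n + 1" using \<Gamma>(3) \<Gamma>\<^sub>0(2) Suc.prems by linarith
      then have "real (card \<Gamma>) \<le> real (?n * (7 * s) + M + ?n + 1)" by (rule of_nat_mono)
      then have "real (card \<Gamma>) \<le> \<kappa> * (real ?n * real d)" using size by linarith
      then obtain e where e: "e \<in> boosters V \<Gamma>" "e \<in> E - H"
        using booster_exists[OF V d E(1) typ_E H(1) H' \<Gamma>(2) _ ex] by blast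
      obtain p' where p': "longest V (insert e \<Gamma>) p'" using longest_exists[OF V(1) n0(2)] by blast
      have "hamiltonian V (insert e \<Gamma>) \<or> length p < length p'"
        by (rule booster_step[OF V(1) ex k e(1) p(1) p'])
      then have "hamiltonian V (insert e \<Gamma>) \<or> (\<exists>p. longest V (insert e \<Gamma>) p \<and> Suc j \<le> length p)"
        using p' p(2) by auto
      moreover have "card (insert e \<Gamma>) \<le> card \<Gamma>\<^sub>0 + Suc j"
        using \<Gamma>(3) finite_subset[of \<Gamma> "E - H"] \<Gamma>(2) fE by (simp add: card_insert_if)
      moreover have "\<Gamma>\<^sub>0 \<subseteq> insert e \<Gamma>" "insert e \<Gamma> \<subseteq> E - H" using \<Gamma> e by blast+
      ultimately show ?thesis by blast
    qed
  qed
  from this[of "?n + 1"] obtain \<Gamma> where \<Gamma>: "\<Gamma> \<subseteq> E - H"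
    "hamiltonian V \<Gamma> \<or> (\<exists>p. longest V \<Gamma> p \<and> ?n + 1 \<le> length p)" by auto
  have "\<not> ?n + 1 \<le> length p" if "longest V \<Gamma> p" for p
    using that card_mono[OF V(1), of "set p"] unfolding longest_def is_path_def by (simp add: distinct_card)
  then have "hamiltonian V \<Gamma>" using \<Gamma>(2) by blast
  then show ?thesis using hamiltonian_mono \<Gamma>(1) by blast
qed

section \<open>Switchings and tail bounds\<close>

text \<open>Regular graphs as bare edge sets, so that switchings and containment of a fixed edge set
  are plain set operations.\<close>

definition reg :: "'a set \<Rightarrow> nat \<Rightarrow> 'a set set set" where
  "reg V d = {E. E \<subseteq> pairs V \<and> (\<forall>v\<in>V. card (nbrs E v) = d)}"

lemma finite_reg: "finite V \<Longrightarrow> finite (reg V d)"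
  by (rule finite_subset[of _ "Pow (pairs V)"]) (auto simp: reg_def finite_pairs)

lemma regD:
  assumes "E \<in> reg V d"
  shows "E \<subseteq> pairs V" "v \<in> V \<Longrightarrow> card (nbrs E v) = d"
  using assms unfolding reg_def by auto

lemma card_swap:
  assumes "finite N" "a \<notin> N" "b \<in> N"
  shows "card (insert a (N - {b})) = card N"
proof -
  have "card N > 0" using assms by (auto simp: card_gt_0_iff)
  then show ?thesis using assms by (simp add: card_Diff_singleton)
qed

definition switch :: "'a \<Rightarrow> 'a \<Rightarrow> 'a \<Rightarrow> 'a \<Rightarrow> 'a set set \<Rightarrow> 'a set set" where
  "switch u v x y E = E - {{u, v}, {x, y}} \<union> {{u, x}, {v, y}}"

lemma switch_reg:
  assumes V: "finite V" and E: "E \<in> reg V d" and uv: "{u, v} \<in> E" and xy: "{x, y} \<in> E"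
    and ne: "x \<notin> {u, v}" "y \<notin> {u, v}" and new: "{u, x} \<notin> E" "{v, y} \<notin> E"
  shows "switch u v x y E \<in> reg V d"
proof -
  have EV: "E \<subseteq> pairs V" using regD(1)[OF E] .
  then have V4: "u \<in> V" "v \<in> V" "u \<noteq> v" "x \<in> V" "y \<in> V" "x \<noteq> y"
    using uv xy by (metis pair_in_pairs subsetD)+
  have sub: "switch u v x y E \<subseteq> pairs V" unfolding switch_def using EV V4 ne by auto
  have nb: "nbrs (switch u v x y E) w =
    (if w = u then insert x (nbrs E u - {v}) else if w = v then insert y (nbrs E v - {u})
     else if w = x then insert u (nbrs E x - {y}) else if w = y then insert v (nbrs E y - {x})
     else nbrs E w)" for w
    unfolding switch_def nbrs_def using V4 ne by (auto simp: doubleton_eq_iff)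
  have fin: "finite (nbrs E w)" for w using finite_nbrs[OF V EV] .
  have mem: "v \<in> nbrs E u" "u \<in> nbrs E v" "y \<in> nbrs E x" "x \<in> nbrs E y"
    "x \<notin> nbrs E u" "u \<notin> nbrs E x" "y \<notin> nbrs E v" "v \<notin> nbrs E y"
    unfolding nbrs_def using uv xy new by (simp_all add: insert_commute)
  have "card (nbrs (switch u v x y E) w) = card (nbrs E w)" for w
    unfolding nb using card_swap[OF fin] mem by simp
  then show ?thesis using E sub unfolding reg_def by auto
qed

text \<open>Double counting of switchings that remove \<open>{u, v}\<close>. The factor on the left
  bounds the number of admissible ordered edges \<open>(x, y)\<close> from below; on the right,
  \<open>x\<close> and \<open>y\<close> are neighbours of \<open>u\<close> and \<open>v\<close> in
  the new graph, which leaves \<open>d * d\<close> choices.\<close>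

lemma switch_count:
  assumes V: "finite V" and e: "{u, v} \<in> F" and F: "finite F" "F \<subseteq> pairs V"
  shows "real (card {E \<in> reg V d. F \<subseteq> E}) * (real (card V) * real d - 2 * card F - (2 * real d ^ 2 + 4 * real d))
    \<le> real d ^ 2 * card {E \<in> reg V d. F - {{u, v}} \<subseteq> E}"
proof -
  define X where "X = {E \<in> reg V d. F \<subseteq> E}"
  define Y where "Y = {E \<in> reg V d. F - {{u, v}} \<subseteq> E}"
  define P where "P E = {(x, y). {x, y} \<in> E - F \<and> x \<notin> {u, v} \<and> y \<notin> {u, v} \<and> {u, x} \<notin> E \<and> {v, y} \<notin> E}" for E
  have fin: "finite X" "finite Y" unfolding X_def Y_def using finite_reg[OF V] by auto
  have uvV: "u \<in> V" "v \<in> V" "u \<noteq> v" using e F(2) by auto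
  have cP: "real (card V) * real d - 2 * card F - (2 * real d ^ 2 + 4 * real d) \<le> card (P E) \<and> finite (P E)"
    if "E \<in> X" for E
  proof -
    have E: "E \<in> reg V d" "F \<subseteq> E" using that X_def by auto
    have EV: "E \<subseteq> pairs V" and deg: "\<And>v. v \<in> V \<Longrightarrow> card (nbrs E v) = d" using regD[OF E(1)] by auto
    have fE: "finite E" using EV V finite_pairs finite_subset by blast
    have fn: "finite (nbrs E w)" for w using finite_nbrs[OF V EV] .
    let ?A = "\<lambda>E. {(x, y). {x, y} \<in> E}"
    define D1 where "D1 = Sigma (nbrs E u) (nbrs E)"
    define D2 where "D2 = prod.swap ` Sigma (nbrs E v) (nbrs E)"
    define S where "S = {u} \<times> nbrs E u \<union> {v} \<times> nbrs E v \<union> nbrs E u \<times> {u} \<union> nbrs E v \<times> {v}"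
    \<comment> \<open>An ordered edge is inadmissible if it belongs to \<open>F\<close>
      (\<open>2 * card F\<close> cases), touches \<open>u\<close> or \<open>v\<close> (at most
      \<open>4 * d\<close>), or would create an edge already present at \<open>u\<close>
      (\<open>D1\<close>) or at \<open>v\<close> (\<open>D2\<close>), with \<open>d * d\<close>
      cases each.\<close>
    have sub: "?A E \<subseteq> P E \<union> ?A F \<union> S \<union> D1 \<union> D2"
    proof
      fix a assume "a \<in> ?A E"
      then obtain x y where a: "a = (x, y)" "{x, y} \<in> E" by blast
      have "(x, y) \<in> D2" if "{v, y} \<in> E"
      proof -
        have "(y, x) \<in> Sigma (nbrs E v) (nbrs E)"
          using that a(2) unfolding nbrs_def by (simp add: insert_commute)
        then show ?thesis unfolding D2_def by force
      qed
      moreover have "(x, y) \<in> D1" if "{u, x} \<in> E"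
        using that a(2) unfolding nbrs_def D1_def by simp
      moreover have "(x, y) \<in> S" if "x \<in> {u, v} \<or> y \<in> {u, v}"
        using that a(2) unfolding S_def nbrs_def by (auto simp: insert_commute)
      ultimately show "a \<in> P E \<union> ?A F \<union> S \<union> D1 \<union> D2" using a unfolding P_def by blast
    qed
    have nV: "nbrs E w \<subseteq> V" for w using nbrs_subset[OF EV] by blast
    have "card D1 = d * d" unfolding D1_def
      using fn deg uvV nV[of u] by (subst card_SigmaI) (auto simp: subset_iff)
    moreover have "card D2 = d * d" unfolding D2_def
    proof (subst card_image)
      show "card (Sigma (nbrs E v) (nbrs E)) = d * d"
        using fn deg uvV nV[of v] by (subst card_SigmaI) (auto simp: subset_iff)
    qed (auto simp: inj_on_def)
    moreover have "card S \<le> 4 * d"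
    proof -
      have "card S \<le> card ({u} \<times> nbrs E u) + card ({v} \<times> nbrs E v) + card (nbrs E u \<times> {u}) + card (nbrs E v \<times> {v})"
        unfolding S_def by (meson add_mono card_Un_le le_trans order_refl)
      then show ?thesis using deg uvV by (simp add: card_cartesian_product)
    qed
    moreover have "card (?A F) = 2 * card F" "finite (?A F)" using card_arcs[OF F] by auto
    moreover have "card (?A E) = card V * d" "finite (?A E)"
      using card_arcs[OF fE EV] sum_card_nbrs[OF V EV] deg by auto
    moreover have fP: "finite (P E)"
      by (rule finite_subset[OF _ \<open>finite (?A E)\<close>]) (auto simp: P_def)
    moreover have "card (?A E) \<le> card (P E) + card (?A F) + card S + card D1 + card D2"
    proof -
      have "finite (P E \<union> ?A F \<union> S \<union> D1 \<union> D2)"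
        using fP \<open>finite (?A F)\<close> fn unfolding S_def D1_def D2_def by auto
      then have "card (?A E) \<le> card (P E \<union> ?A F \<union> S \<union> D1 \<union> D2)" using sub by (rule card_mono)
      then show ?thesis by (meson add_mono card_Un_le le_trans order_refl)
    qed
    ultimately have "card V * d \<le> card (P E) + 2 * card F + 4 * d + d * d + d * d" by linarith
    then have "real (card V * d) \<le> real (card (P E) + 2 * card F + 4 * d + d * d + d * d)"
      by (rule of_nat_mono)
    then show ?thesis using fP by (simp add: power2_eq_square)
  qed
  \<comment> \<open>Keeping \<open>x\<close> and \<open>y\<close> in the image makes the switching
    reversible, see \<open>undo\<close>.\<close>
  define \<phi> where "\<phi> = (\<lambda>(E, x, y). (switch u v x y E, x, y))"
  have im: "\<phi> ` Sigma X P \<subseteq> Sigma Y (\<lambda>E. nbrs E u \<times> nbrs E v)"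
  proof
    fix z assume "z \<in> \<phi> ` Sigma X P"
    then obtain E x y where z: "z = (switch u v x y E, x, y)" "E \<in> X" "(x, y) \<in> P E"
      unfolding \<phi>_def by auto
    have "switch u v x y E \<in> reg V d"
      using z switch_reg[OF V, of E d u v x y] e unfolding X_def P_def by auto
    moreover have "F - {{u, v}} \<subseteq> switch u v x y E"
      using z unfolding X_def P_def switch_def by auto
    ultimately show "z \<in> Sigma Y (\<lambda>E. nbrs E u \<times> nbrs E v)"
      using z(1) unfolding Y_def nbrs_def switch_def by auto
  qed
  have inj: "inj_on \<phi> (Sigma X P)"
  proof -
    have undo: "E = switch u v x y E - {{u, x}, {v, y}} \<union> {{u, v}, {x, y}}" if "E \<in> X" "(x, y) \<in> P E" for E x y
      using that e unfolding X_def P_def switch_def by auto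
    show ?thesis
    proof (rule inj_onI)
      fix a b assume a: "a \<in> Sigma X P" and b: "b \<in> Sigma X P" and ab: "\<phi> a = \<phi> b"
      obtain E x y E' where abe: "a = (E, x, y)" "b = (E', x, y)" "switch u v x y E = switch u v x y E'"
        using ab unfolding \<phi>_def by (auto split: prod.splits)
      then show "a = b" using undo[of E x y] undo[of E' x y] a b by auto
    qed
  qed
  have fY: "finite (nbrs E u \<times> nbrs E v)" "card (nbrs E u \<times> nbrs E v) = d * d" if "E \<in> Y" for E
  proof -
    have E: "E \<in> reg V d" using that unfolding Y_def by blast
    show "finite (nbrs E u \<times> nbrs E v)" using finite_nbrs[OF V regD(1)[OF E]] by blast
    show "card (nbrs E u \<times> nbrs E v) = d * d"
      using regD(2)[OF E] uvV by (simp add: card_cartesian_product)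
  qed
  have "card (Sigma X P) = card (\<phi> ` Sigma X P)" using inj by (simp add: card_image)
  also have "\<dots> \<le> card (Sigma Y (\<lambda>E. nbrs E u \<times> nbrs E v))"
    using im fin fY by (intro card_mono) auto
  also have "\<dots> = card Y * (d * d)" using fin fY by (subst card_SigmaI) auto
  finally have up: "real (card (Sigma X P)) \<le> card Y * (real d * real d)"
    by (metis of_nat_le_iff of_nat_mult)
  have "card X * (real (card V) * real d - 2 * card F - (2 * real d ^ 2 + 4 * real d))
    = (\<Sum>E\<in>X. real (card V) * real d - 2 * card F - (2 * real d ^ 2 + 4 * real d))" by simp
  also have "\<dots> \<le> (\<Sum>E\<in>X. real (card (P E)))" using cP by (intro sum_mono) blast
  also have "\<dots> = card (Sigma X P)" using fin cP by (subst card_SigmaI) auto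
  finally show ?thesis using up unfolding X_def Y_def by (simp add: power2_eq_square mult.commute)
qed

text \<open>Removing the edges of \<open>F\<close> one at a time, each application of
  \<open>switch_count\<close> gains a factor \<open>p\<close>. The bound \<open>M\<close> on the
  size of \<open>F\<close> makes the same \<open>p\<close>, close to \<open>d / card V\<close>,
  valid in every round.\<close>

lemma count_superset:
  fixes p M :: real
  assumes V: "finite V" and F: "finite F" "real (card F) \<le> M" and p: "p \<ge> 0"
    and M: "real d ^ 2 \<le> p * (real (card V) * real d - 2 * M - (2 * real d ^ 2 + 4 * real d))"
    and pos: "real (card V) * real d - 2 * M - (2 * real d ^ 2 + 4 * real d) > 0"
  shows "card {E \<in> reg V d. F \<subseteq> E} \<le> p ^ card F * card (reg V d)"
  using F
proof (induction F rule: finite_induct)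
  case empty
  then show ?case by simp
next
  case (insert e F)
  define C where "C = real (card V) * real d - 2 * M - (2 * real d ^ 2 + 4 * real d)"
  show ?case
  proof (cases "insert e F \<subseteq> pairs V")
    case False
    then have "{E \<in> reg V d. insert e F \<subseteq> E} = {}" using regD(1) by blast
    then show ?thesis using p by (simp only:) simp
  next
    case True
    then obtain u v where uv: "e = {u, v}" by (auto elim: pairsE)
    let ?x = "real (card {E \<in> reg V d. insert e F \<subseteq> E})"
    let ?y = "real (card {E \<in> reg V d. F \<subseteq> E})"
    have Fe: "insert e F - {{u, v}} = F" using insert uv by auto
    have "C * ?x \<le> ?x * (real (card V) * real d - 2 * card (insert e F) - (2 * real d ^ 2 + 4 * real d))"
      unfolding C_def mult.commute[of _ ?x] using insert.prems by (intro mult_left_mono) auto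
    also have "\<dots> \<le> real d ^ 2 * ?y"
      using switch_count[OF V, of u v "insert e F" d] uv insert.hyps True unfolding Fe by simp
    also have "\<dots> \<le> (p * C) * ?y" using M unfolding C_def by (intro mult_right_mono) auto
    finally have "C * ?x \<le> C * (p * ?y)" by (simp add: mult_ac)
    then have "?x \<le> p * ?y" using pos unfolding C_def by simp
    also have "\<dots> \<le> p * (p ^ card F * card (reg V d))"
      using insert p by (intro mult_left_mono) auto
    finally show ?thesis using insert by simp
  qed
qed

section \<open>Factorial moments and the union bound over sparse subgraphs\<close>

lemma power_le_binomial_fact:
  assumes "m \<le> b" "b \<le> a"
  shows "(real a - real b) ^ m \<le> real (a choose m) * fact m"
  using assms
proof (induction m)
  case (Suc m)
  have "Suc m * (a choose Suc m) = (a - m) * (a choose m)"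
    using binomial_absorption[of m "a"] binomial_absorb_comp[of a m] by simp
  then have "real (Suc m) * real (a choose Suc m) = (real a - real m) * real (a choose m)"
    using Suc.prems by (metis Suc_leD le_trans of_nat_diff of_nat_mult)
  then have "fact m * (real (Suc m) * real (a choose Suc m)) = fact m * ((real a - real m) * real (a choose m))"
    by (rule arg_cong)
  then have "(real a - real m) * (real (a choose m) * fact m) = real (a choose Suc m) * fact (Suc m)"
    by (simp only: fact_Suc mult_ac)
  moreover have "(real a - real b) * (real a - real b) ^ m \<le> (real a - real m) * (real (a choose m) * fact m)"
    using Suc by (intro mult_mono) auto
  ultimately show ?case by (simp only: power_Suc)
qed simp

text \<open>A factorial moment bound: count pairs of a bad \<open>E\<close> and an
  \<open>m\<close>-subset \<open>F\<close> of \<open>E \<inter> Q\<close>. Each bad \<open>E\<close>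
  has at least \<open>(K - m) ^ m / fact m\<close> such subsets, and \<open>count_superset\<close>
  applies to the union of \<open>F\<close> and \<Gamma>. The factor for \<Gamma> is kept to pay for
  the later sum over \<Gamma>.\<close>

lemma tail_count:
  fixes p M K :: real
  assumes V: "finite V" and \<Gamma>: "finite \<Gamma>" and Q: "finite Q" "\<Gamma> \<inter> Q = {}"
    and m: "real m + card \<Gamma> \<le> M" "real m < K" and p: "p \<ge> 0"
    and M: "real d ^ 2 \<le> p * (real (card V) * real d - 2 * M - (2 * real d ^ 2 + 4 * real d))"
    and pos: "real (card V) * real d - 2 * M - (2 * real d ^ 2 + 4 * real d) > 0"
  shows "card {E \<in> reg V d. \<Gamma> \<subseteq> E \<and> K \<le> card (E \<inter> Q)}
    \<le> (card Q * p / (K - m)) ^ m * p ^ card \<Gamma> * card (reg V d)"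
proof -
  define X where "X = {E \<in> reg V d. \<Gamma> \<subseteq> E \<and> K \<le> card (E \<inter> Q)}"
  define S where "S = {F. F \<subseteq> Q \<and> card F = m}"
  have fX: "finite X" unfolding X_def using finite_reg[OF V] by auto
  have fS: "finite S" unfolding S_def using Q by auto
  have low: "(K - m) ^ m \<le> real (card {F \<in> S. F \<subseteq> E}) * fact m" if "E \<in> X" for E
  proof -
    have K: "K \<le> card (E \<inter> Q)" using that unfolding X_def by blast
    have "{F \<in> S. F \<subseteq> E} = {F. F \<subseteq> E \<inter> Q \<and> card F = m}" unfolding S_def by blast
    then have c: "card {F \<in> S. F \<subseteq> E} = card (E \<inter> Q) choose m" using n_subsets[of "E \<inter> Q" m] Q by simp
    have "(K - m) ^ m \<le> (real (card (E \<inter> Q)) - real m) ^ m" using K m by (intro power_mono) auto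
    also have "\<dots> \<le> real (card (E \<inter> Q) choose m) * fact m"
      using K m by (intro power_le_binomial_fact) auto
    finally show ?thesis unfolding c by simp
  qed
  have up: "real (card {E \<in> X. F \<subseteq> E}) \<le> p ^ (m + card \<Gamma>) * card (reg V d)" if F: "F \<in> S" for F
  proof -
    have fF: "finite F" "F \<inter> \<Gamma> = {}" "card F = m" using F Q unfolding S_def by (auto intro: finite_subset)
    then have c: "card (F \<union> \<Gamma>) = m + card \<Gamma>" using \<Gamma> by (simp add: card_Un_disjoint)
    have "real (card {E \<in> X. F \<subseteq> E}) \<le> card {E \<in> reg V d. F \<union> \<Gamma> \<subseteq> E}"
      using finite_reg[OF V] by (intro of_nat_mono card_mono) (auto simp: X_def)
    also have "\<dots> \<le> p ^ card (F \<union> \<Gamma>) * card (reg V d)"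
      using fF \<Gamma> c m p M pos by (intro count_superset[OF V, of _ M]) auto
    finally show ?thesis unfolding c .
  qed
  have "card X * (K - m) ^ m = (\<Sum>E\<in>X. (K - m) ^ m)" by simp
  also have "\<dots> \<le> (\<Sum>E\<in>X. real (card {F \<in> S. F \<subseteq> E}) * fact m)" using low by (intro sum_mono) auto
  also have "\<dots> = (\<Sum>E\<in>X. \<Sum>F\<in>S. if F \<subseteq> E then fact m else 0)"
    using fS by (intro sum.cong refl) (simp add: sum.If_cases Int_def)
  also have "\<dots> = (\<Sum>F\<in>S. \<Sum>E\<in>X. if F \<subseteq> E then fact m else 0)" by (rule sum.swap)
  also have "\<dots> = (\<Sum>F\<in>S. real (card {E \<in> X. F \<subseteq> E}) * fact m)"
    using fX by (intro sum.cong refl) (simp add: sum.If_cases Int_def)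
  also have "\<dots> \<le> (\<Sum>F\<in>S. p ^ (m + card \<Gamma>) * card (reg V d) * fact m)"
    using up by (intro sum_mono mult_right_mono) auto
  also have "\<dots> = (real (card S) * fact m) * (p ^ (m + card \<Gamma>) * card (reg V d))" by simp
  also have "\<dots> \<le> card Q ^ m * (p ^ (m + card \<Gamma>) * card (reg V d))"
  proof (rule mult_right_mono)
    have "card S = card Q choose m" unfolding S_def using n_subsets[OF Q(1)] by simp
    then have "card S * fact m \<le> card Q ^ m" using binomial_fact_pow[of "card Q" m] by simp
    then show "real (card S) * fact m \<le> real (card Q ^ m)" by (metis of_nat_fact of_nat_le_iff of_nat_mult)
  qed (use p in simp)
  finally have *: "card X * (K - m) ^ m \<le> card Q ^ m * (p ^ (m + card \<Gamma>) * card (reg V d))" by simp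
  have "(K - m) ^ m > 0" using m by simp
  then have "card X \<le> card Q ^ m * (p ^ (m + card \<Gamma>) * card (reg V d)) / (K - m) ^ m"
    using * by (simp add: pos_le_divide_eq)
  also have "\<dots> = (card Q * p / (K - m)) ^ m * p ^ card \<Gamma> * card (reg V d)"
    by (simp add: power_add power_mult_distrib power_divide)
  finally show ?thesis unfolding X_def .
qed

lemma sum_Pow_card_power:
  fixes x :: real
  assumes "finite A"
  shows "(\<Sum>S\<in>Pow A. x ^ card S) = (1 + x) ^ card A"
  using assms
proof (induction A rule: finite_induct)
  case (insert a A)
  have disj: "Pow A \<inter> insert a ` Pow A = {}" using insert by blast
  have inj: "inj_on (insert a) (Pow A)" using insert by (auto simp: inj_on_def)
  have "(\<Sum>S\<in>Pow (insert a A). x ^ card S) = (\<Sum>S\<in>Pow A. x ^ card S) + (\<Sum>S\<in>insert a ` Pow A. x ^ card S)"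
    unfolding Pow_insert using insert disj by (subst sum.union_disjoint) auto
  also have "(\<Sum>S\<in>insert a ` Pow A. x ^ card S) = (\<Sum>S\<in>Pow A. x * x ^ card S)"
    unfolding sum.reindex[OF inj] o_def
  proof (intro sum.cong refl)
    fix S assume "S \<in> Pow A"
    then have "a \<notin> S" "finite S" using insert finite_subset by auto
    then show "x ^ card (insert a S) = x * x ^ card S" by simp
  qed
  finally show ?case using insert by (simp add: sum_distrib_left[symmetric] algebra_simps)
qed simp

text \<open>Exponential tilting: for \<open>card S \<le> g\<close> the weight
  \<open>z powr (- g) * z ^ card S\<close> is at least 1. Inserting it and summing over all subsets
  gives a binomial power.\<close>

lemma sum_small_subsets:
  fixes p z g :: real
  assumes A: "finite A" and p: "p \<ge> 0" and z: "0 < z" "z \<le> 1"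
  shows "(\<Sum>S\<in>{S\<in>Pow A. card S \<le> g}. p ^ card S) \<le> z powr (- g) * exp (z * p * card A)"
proof -
  have "(\<Sum>S\<in>{S\<in>Pow A. card S \<le> g}. p ^ card S) \<le> (\<Sum>S\<in>{S\<in>Pow A. card S \<le> g}. z powr (- g) * (z * p) ^ card S)"
  proof (rule sum_mono)
    fix S assume "S \<in> {S\<in>Pow A. card S \<le> g}"
    then have "z powr g \<le> z powr card S" using z by (intro powr_mono') auto
    then have "1 \<le> z powr (- g) * z ^ card S"
      using z by (simp add: powr_minus powr_realpow field_simps)
    then have "1 * p ^ card S \<le> (z powr (- g) * z ^ card S) * p ^ card S"
      using p by (intro mult_right_mono) auto
    then show "p ^ card S \<le> z powr (- g) * (z * p) ^ card S" by (simp add: power_mult_distrib mult_ac)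
  qed
  also have "\<dots> \<le> (\<Sum>S\<in>Pow A. z powr (- g) * (z * p) ^ card S)"
    using A p z by (intro sum_mono2) auto
  also have "\<dots> = z powr (- g) * (1 + z * p) ^ card A"
    using sum_Pow_card_power[OF A] by (simp add: sum_distrib_left[symmetric])
  also have "(1 + z * p) ^ card A \<le> exp (z * p) ^ card A"
    using p z by (intro power_mono) auto
  also have "\<dots> = exp (z * p * card A)" by (simp add: exp_of_nat_mult[symmetric] mult.commute)
  finally show ?thesis using z by (simp add: mult_left_mono)
qed

text \<open>This is the base of the power in \<open>tail_count\<close> for expected count
  \<open>x\<close>, excess \<open>\<delta> * N\<close> and moment order \<open>m\<close>. The excess
  left after subtracting \<open>m\<close> outweighs the factor \<open>1 / (1 - \<delta>)\<close>
  coming from the switching loss.\<close>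

lemma tail_ratio:
  fixes \<delta> N x m :: real
  assumes \<delta>: "0 < \<delta>" "\<delta> \<le> 1 / 6" and x: "0 \<le> x" "x \<le> N / 2" and m: "m \<le> \<delta> * N / 4" and N: "N > 0"
  shows "0 \<le> x / (1 - \<delta>) / (x + \<delta> * N - m)" "x / (1 - \<delta>) / (x + \<delta> * N - m) \<le> exp (- (\<delta> / 8))"
proof -
  have "\<delta> * N > 0" using \<delta> N by simp
  then have den: "x + \<delta> * N - m > 0" using m x by linarith
  then show "0 \<le> x / (1 - \<delta>) / (x + \<delta> * N - m)" using x \<delta> by simp
  have "1 \<le> (1 - \<delta>) * (1 - \<delta> / 8) * (1 + 3 * \<delta> / 2)"
  proof -
    have "(1 - \<delta>) * (1 - \<delta> / 8) * (1 + 3 * \<delta> / 2) = 1 + \<delta> * (3 / 8 - 25 / 16 * \<delta>) + 3 / 16 * \<delta> ^ 3"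
      by (simp add: field_simps power3_eq_cube)
    moreover have "0 \<le> \<delta> * (3 / 8 - 25 / 16 * \<delta>)" using \<delta> by (intro mult_nonneg_nonneg) linarith+
    moreover have "0 \<le> 3 / 16 * \<delta> ^ 3" using \<delta> by simp
    ultimately show ?thesis by linarith
  qed
  then have "x * 1 \<le> x * ((1 - \<delta>) * (1 - \<delta> / 8) * (1 + 3 * \<delta> / 2))" using x by (intro mult_left_mono) auto
  also have "\<dots> = (1 - \<delta>) * (1 - \<delta> / 8) * (x + 3 * \<delta> / 4 * (2 * x))"
  proof -
    have "x + 3 * \<delta> / 4 * (2 * x) = x * (1 + 3 * \<delta> / 2)" by (simp add: algebra_simps)
    then show ?thesis by (simp only: mult_ac)
  qed
  also have "\<dots> \<le> (1 - \<delta>) * (1 - \<delta> / 8) * (x + \<delta> * N - m)"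
  proof (rule mult_left_mono)
    have "3 * \<delta> / 4 * (2 * x) \<le> 3 * \<delta> / 4 * N" using x \<delta> by (intro mult_left_mono) auto
    then show "x + 3 * \<delta> / 4 * (2 * x) \<le> x + \<delta> * N - m"
      using m by (simp add: mult.commute[of N \<delta>])
  qed (use \<delta> in simp)
  finally have "x / (1 - \<delta>) / (x + \<delta> * N - m) \<le> 1 - \<delta> / 8"
    using den \<delta> by (simp add: pos_divide_le_eq mult_ac)
  also have "\<dots> \<le> exp (- (\<delta> / 8))" using exp_ge_add_one_self[of "- (\<delta> / 8)"] by simp
  finally show "x / (1 - \<delta>) / (x + \<delta> * N - m) \<le> exp (- (\<delta> / 8))" .
qed

text \<open>Since the number of edges is fixed, the lower tail on \<open>\<Phi> i \<Gamma>\<close> follows from the upper tail on the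
  complementary pairs.\<close>

lemma edge_concentration:
  fixes \<delta> \<kappa> :: real and \<Phi> :: "'i \<Rightarrow> 'a set set \<Rightarrow> 'a set set"
  assumes V: "finite V" and \<delta>: "0 < \<delta>" "\<delta> \<le> 1 / 6"
    and \<kappa>: "0 < \<kappa>" "\<kappa> \<le> \<delta> / 8" "\<kappa> * ln (200 / \<delta>\<^sup>2) \<le> \<delta>\<^sup>2 / 200"
    and d: "d > 0" and n: "8 * real d + 16 \<le> \<delta> * card V"
    and I: "finite I" and \<Phi>: "\<And>i \<Gamma>. \<Phi> i \<Gamma> \<subseteq> pairs V"
  shows "card {E \<in> reg V d. \<exists>i\<in>I. \<exists>\<Gamma>\<subseteq>E. card \<Gamma> \<le> \<kappa> * (real (card V) * real d) \<and>
      real (card (E \<inter> \<Phi> i \<Gamma>)) < real (card (\<Phi> i \<Gamma>)) * real d / real (card V) - 2 * \<delta> * (real (card V) * real d)}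
    \<le> card I * exp (- (\<delta>\<^sup>2 / 200 * (real (card V) * real d))) * card (reg V d)"
    (is "real (card ?Bad) \<le> _")
proof -
  define n where "n = real (card V)"
  define N where "N = n * real d"
  \<comment> \<open>All losses in the switching denominator together stay below
    \<open>\<delta> * N\<close>.\<close>
  define p where "p = real d / (n * (1 - \<delta>))"
  \<comment> \<open>The moment order is a constant fraction of the number of edges, which makes the
    tail exponentially small in \<open>N\<close>, and it is within the range of
    \<open>tail_ratio\<close>.\<close>
  define m where "m = nat \<lfloor>\<delta> * N / 4\<rfloor>"
  define M where "M = real m + \<kappa> * N"
  define z where "z = \<delta>\<^sup>2 / 200"
  define R where "R = real (card (reg V d))"
  define S where "S = {\<Gamma> \<in> Pow (pairs V). card \<Gamma> \<le> \<kappa> * N}"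
  \<comment> \<open>Removing \<Gamma> provides the disjointness demanded by
    \<open>tail_count\<close>.\<close>
  define Q where "Q i \<Gamma> = pairs V - \<Phi> i \<Gamma> - \<Gamma>" for i \<Gamma>
  define K where "K i \<Gamma> = card (Q i \<Gamma>) * real d / n + \<delta> * N" for i \<Gamma>
  define bad where "bad i \<Gamma> = {E \<in> reg V d. \<Gamma> \<subseteq> E \<and> K i \<Gamma> \<le> card (E \<inter> Q i \<Gamma>)}" for i \<Gamma>
  have fp: "finite (pairs V)" using finite_pairs[OF V] .
  have fS: "finite S" unfolding S_def using fp by auto
  have n0: "n > 0"
  proof (rule ccontr)
    assume "\<not> ?thesis"
    then have "\<delta> * n \<le> 0" unfolding n_def using \<delta> by (simp add: mult_le_0_iff)
    then show False using n unfolding n_def by linarith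
  qed
  have N0: "N > 0" unfolding N_def using n0 d by simp
  have dn: "8 * real d ^ 2 + 16 * real d \<le> \<delta> * N"
    using mult_right_mono[OF n, of "real d"] unfolding N_def n_def by (simp add: algebra_simps power2_eq_square)
  have dN: "24 \<le> \<delta> * N"
  proof -
    have "1 \<le> real d" using d by simp
    moreover have "1 \<le> real d ^ 2" using \<open>1 \<le> real d\<close> by (rule one_le_power)
    ultimately show ?thesis using dn by linarith
  qed
  have m: "real m \<le> \<delta> * N / 4" "\<delta> * N / 8 \<le> real m" unfolding m_def using dN by linarith+
  have p0: "p \<ge> 0" unfolding p_def using n0 \<delta> by simp
  have cp: "real (card (pairs V)) \<le> n ^ 2 / 2" unfolding n_def by (rule card_pairs_le[OF V])
  \<comment> \<open>Of the allowance \<open>\<delta> * N\<close>, one half goes to \<open>m\<close>,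
    a quarter to \<Gamma> through \<open>\<kappa> \<le> \<delta> / 8\<close>, and a quarter to the
    terms in \<open>d\<close> alone.\<close>
  have MM: "(1 - \<delta>) * N \<le> N - 2 * M - (2 * real d ^ 2 + 4 * real d)"
  proof -
    have "\<kappa> * N \<le> \<delta> / 8 * N" using \<kappa> N0 by (intro mult_right_mono) auto
    then show ?thesis unfolding M_def using m dn by (simp add: algebra_simps)
  qed
  have pos: "N - 2 * M - (2 * real d ^ 2 + 4 * real d) > 0"
  proof -
    have "(1 - \<delta>) * N > 0" using N0 \<delta> by simp
    then show ?thesis using MM by linarith
  qed
  have pM: "real d ^ 2 \<le> p * (N - 2 * M - (2 * real d ^ 2 + 4 * real d))"
  proof -
    have "real d ^ 2 = p * ((1 - \<delta>) * N)"
      unfolding p_def N_def using n0 \<delta> by (simp add: power2_eq_square)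
    also have "\<dots> \<le> p * (N - 2 * M - (2 * real d ^ 2 + 4 * real d))"
      using MM p0 by (rule mult_left_mono)
    finally show ?thesis .
  qed
  have sub: "?Bad \<subseteq> (\<Union>i\<in>I. \<Union>\<Gamma>\<in>S. bad i \<Gamma>)"
  proof
    fix E assume "E \<in> ?Bad"
    then obtain i \<Gamma> where E: "E \<in> reg V d" "i \<in> I" "\<Gamma> \<subseteq> E" "card \<Gamma> \<le> \<kappa> * N"
      "real (card (E \<inter> \<Phi> i \<Gamma>)) < real (card (\<Phi> i \<Gamma>)) * real d / n - 2 * \<delta> * N"
      unfolding N_def n_def by blast
    have EV: "E \<subseteq> pairs V" and deg: "\<And>v. v \<in> V \<Longrightarrow> card (nbrs E v) = d" using regD[OF E(1)] by auto
    have fE: "finite E" using EV fp finite_subset by blast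
    have f\<Gamma>: "finite \<Gamma>" using E(3) fE finite_subset by blast
    have "2 * card E = card V * d" using sum_card_nbrs[OF V EV] deg by simp
    then have "2 * real (card E) = N" unfolding N_def n_def by (metis of_nat_mult of_nat_numeral)
    moreover have "card E \<le> card (E \<inter> \<Phi> i \<Gamma>) + card (E \<inter> Q i \<Gamma>) + card \<Gamma>"
    proof -
      have "E \<subseteq> (E \<inter> \<Phi> i \<Gamma>) \<union> (E \<inter> Q i \<Gamma>) \<union> \<Gamma>" unfolding Q_def using EV by blast
      then have "card E \<le> card ((E \<inter> \<Phi> i \<Gamma>) \<union> (E \<inter> Q i \<Gamma>) \<union> \<Gamma>)"
        using fE f\<Gamma> by (intro card_mono) auto
      also have "\<dots> \<le> card (E \<inter> \<Phi> i \<Gamma>) + card (E \<inter> Q i \<Gamma>) + card \<Gamma>"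
        by (meson add_mono card_Un_le le_trans order_refl)
      finally show ?thesis .
    qed
    then have "real (card E) \<le> real (card (E \<inter> \<Phi> i \<Gamma>)) + card (E \<inter> Q i \<Gamma>) + card \<Gamma>" by linarith
    moreover have "card (Q i \<Gamma>) * real d / n + card (\<Phi> i \<Gamma>) * real d / n \<le> N / 2"
    proof -
      have "card (Q i \<Gamma>) + card (\<Phi> i \<Gamma>) = card (Q i \<Gamma> \<union> \<Phi> i \<Gamma>)"
        unfolding Q_def using fp finite_subset[OF \<Phi> fp] by (subst card_Un_disjoint) auto
      also have "\<dots> \<le> card (pairs V)"
        using \<Phi> fp unfolding Q_def by (intro card_mono) auto
      finally have "real (card (Q i \<Gamma>) + card (\<Phi> i \<Gamma>)) \<le> n ^ 2 / 2"
        using cp by (meson of_nat_le_iff order_trans)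
      then have "real (card (Q i \<Gamma>) + card (\<Phi> i \<Gamma>)) * (real d / n) \<le> n ^ 2 / 2 * (real d / n)"
        using n0 by (intro mult_right_mono) auto
      then show ?thesis unfolding N_def using n0 by (simp add: power2_eq_square add_divide_distrib distrib_right)
    qed
    moreover have "\<kappa> * N \<le> \<delta> * N" using \<kappa> N0 \<delta> by (intro mult_right_mono) auto
    \<comment> \<open>There are exactly \<open>N / 2\<close> edges. A deficit of
      \<open>2 * \<delta> * N\<close> on \<Phi>, less at most \<open>\<kappa> * N\<close> edges of
      \<Gamma>, is an excess of at least \<open>\<delta> * N\<close> on \<open>Q\<close>.\<close>
    ultimately have "K i \<Gamma> \<le> card (E \<inter> Q i \<Gamma>)"
      using E(4,5) unfolding K_def by linarith
    then have "E \<in> bad i \<Gamma>" unfolding bad_def using E by blast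
    moreover have "\<Gamma> \<in> S" unfolding S_def using E EV by blast
    ultimately show "E \<in> (\<Union>i\<in>I. \<Union>\<Gamma>\<in>S. bad i \<Gamma>)" using E(2) by blast
  qed
  have cbad: "real (card (bad i \<Gamma>)) \<le> exp (- (\<delta> / 8)) ^ m * R * p ^ card \<Gamma>" if \<Gamma>: "\<Gamma> \<in> S" for i \<Gamma>
  proof -
    define x where "x = card (Q i \<Gamma>) * real d / n"
    have f\<Gamma>: "finite \<Gamma>" using \<Gamma> fp finite_subset unfolding S_def by blast
    have x: "0 \<le> x" "x \<le> N / 2"
    proof -
      show "0 \<le> x" unfolding x_def using n0 by simp
      have "card (Q i \<Gamma>) \<le> card (pairs V)" unfolding Q_def using fp by (intro card_mono) auto
      then have "real (card (Q i \<Gamma>)) \<le> n ^ 2 / 2" using cp by linarith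
      then have "real (card (Q i \<Gamma>)) * (real d / n) \<le> n ^ 2 / 2 * (real d / n)"
        using n0 by (intro mult_right_mono) auto
      then show "x \<le> N / 2" unfolding x_def N_def using n0 by (simp add: power2_eq_square)
    qed
    have "real (card (bad i \<Gamma>)) \<le> (card (Q i \<Gamma>) * p / (K i \<Gamma> - m)) ^ m * p ^ card \<Gamma> * R"
      unfolding bad_def R_def
    proof (rule tail_count[OF V f\<Gamma>])
      show "finite (Q i \<Gamma>)" "\<Gamma> \<inter> Q i \<Gamma> = {}" unfolding Q_def using fp by auto
      show "real m + real (card \<Gamma>) \<le> M" using \<Gamma> unfolding M_def S_def by simp
      show "real m < K i \<Gamma>" using x m dN unfolding K_def x_def by linarith
    qed (use p0 pM pos in \<open>simp_all add: N_def n_def\<close>)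
    also have "card (Q i \<Gamma>) * p / (K i \<Gamma> - m) = x / (1 - \<delta>) / (x + \<delta> * N - m)"
      unfolding x_def K_def p_def by simp
    also have "(x / (1 - \<delta>) / (x + \<delta> * N - m)) ^ m \<le> exp (- (\<delta> / 8)) ^ m"
      using tail_ratio[OF \<delta> x m(1) N0] by (intro power_mono)
    finally show ?thesis using p0 by (simp add: mult_ac mult_right_mono R_def)
  qed
  have z: "0 < z" "z \<le> 1"
  proof -
    show "0 < z" unfolding z_def using \<delta> by simp
    have "\<delta>\<^sup>2 \<le> 1" using \<delta> by (intro power_le_one) auto
    then show "z \<le> 1" unfolding z_def by simp
  qed
  have fin: "finite (bad i \<Gamma>)" for i \<Gamma> unfolding bad_def using finite_reg[OF V] by auto
  have "card ?Bad \<le> card (\<Union>i\<in>I. \<Union>\<Gamma>\<in>S. bad i \<Gamma>)"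
    using sub I fS fin by (intro card_mono) auto
  also have "\<dots> \<le> (\<Sum>i\<in>I. card (\<Union>\<Gamma>\<in>S. bad i \<Gamma>))" by (rule card_UN_le[OF I])
  also have "\<dots> \<le> (\<Sum>i\<in>I. \<Sum>\<Gamma>\<in>S. card (bad i \<Gamma>))" by (intro sum_mono card_UN_le[OF fS])
  finally have "card ?Bad \<le> (\<Sum>i\<in>I. \<Sum>\<Gamma>\<in>S. card (bad i \<Gamma>))" .
  then have "real (card ?Bad) \<le> real (\<Sum>i\<in>I. \<Sum>\<Gamma>\<in>S. card (bad i \<Gamma>))" by (rule of_nat_mono)
  also have "\<dots> = (\<Sum>i\<in>I. \<Sum>\<Gamma>\<in>S. real (card (bad i \<Gamma>)))" by (simp only: of_nat_sum)
  also have "\<dots> \<le> (\<Sum>i\<in>I. \<Sum>\<Gamma>\<in>S. exp (- (\<delta> / 8)) ^ m * R * p ^ card \<Gamma>)"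
    using cbad by (intro sum_mono)
  also have "\<dots> = card I * (exp (- (\<delta> / 8)) ^ m * R * (\<Sum>\<Gamma>\<in>S. p ^ card \<Gamma>))"
    by (simp add: sum_distrib_left)
  also have "\<dots> \<le> card I * (exp (- (\<delta> / 8)) ^ m * R * (z powr (- (\<kappa> * N)) * exp (z * p * card (pairs V))))"
    unfolding S_def using sum_small_subsets[OF fp p0 z] by (intro mult_left_mono) (auto simp: R_def)
  also have "\<dots> = card I * exp (- (\<delta> / 8 * m) + \<kappa> * N * ln (1 / z) + z * p * card (pairs V)) * R"
  proof -
    have "exp (- (\<delta> / 8)) ^ m = exp (- (\<delta> / 8 * m))"
      by (simp add: exp_of_nat_mult[symmetric] mult.commute)
    moreover have "z powr (- (\<kappa> * N)) = exp (\<kappa> * N * ln (1 / z))"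
      using z by (simp add: powr_def ln_div)
    ultimately show ?thesis by (simp only: exp_add mult_ac)
  qed
  also have "\<dots> \<le> card I * exp (- (z * N)) * R"
  proof (intro mult_right_mono mult_left_mono)
    \<comment> \<open>The gain is \<open>200 / 64 * (z * N)\<close>, more than
      \<open>3 * (z * N)\<close>. Choosing \<Gamma> costs two terms of at most \<open>z * N\<close>
      each, so the exponent is at most \<open>- (z * N)\<close>.\<close>
    have a: "\<delta> / 8 * (\<delta> * N / 8) \<le> \<delta> / 8 * m" using m \<delta> by (intro mult_left_mono) auto
    have "\<kappa> * ln (1 / z) \<le> z" using \<kappa>(3) unfolding z_def by simp
    then have b: "\<kappa> * ln (1 / z) * N \<le> z * N" using N0 by (intro mult_right_mono) auto
    have "p * card (pairs V) \<le> p * (n ^ 2 / 2)" using cp p0 by (rule mult_left_mono)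
    also have "\<dots> = N * (1 / (2 * (1 - \<delta>)))" 
    proof -
      have "real d / (n * q) * (n ^ 2 / 2) = n * real d * (1 / (2 * q))" if "q \<noteq> 0" for q
        using n0 that by (simp add: power2_eq_square field_simps)
      then show ?thesis unfolding p_def N_def using \<delta> by simp
    qed
    also have "\<dots> \<le> N * 1" using \<delta> N0 by (intro mult_left_mono) (auto simp: field_simps)
    finally have "z * (p * card (pairs V)) \<le> z * N" using z by (intro mult_left_mono) auto
    moreover have "\<delta> / 8 * (\<delta> * N / 8) = 200 / 64 * (z * N)" unfolding z_def by (simp add: power2_eq_square)
    moreover have "z * N \<ge> 0" using z N0 by simp
    ultimately have "- (\<delta> / 8 * m) + \<kappa> * N * ln (1 / z) + z * p * card (pairs V) \<le> - (z * N)"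
    proof -
      have "\<kappa> * N * ln (1 / z) \<le> z * N" using b by (simp only: mult_ac)
      moreover have "z * p * card (pairs V) \<le> z * N"
        using \<open>z * (p * card (pairs V)) \<le> z * N\<close> by (simp only: mult_ac)
      ultimately show ?thesis
        using a \<open>\<delta> / 8 * (\<delta> * N / 8) = 200 / 64 * (z * N)\<close> \<open>z * N \<ge> 0\<close> by linarith
    qed
    then show "exp (- (\<delta> / 8 * m) + \<kappa> * N * ln (1 / z) + z * p * card (pairs V)) \<le> exp (- (z * N))" by simp
  qed (auto simp: R_def)
  finally show ?thesis unfolding z_def N_def n_def R_def .
qed

section \<open>Small sets span few edges\<close>

text \<open>The ratio of consecutive left sides is controlled by
  \<open>(1 + 1 / k) ^ k \<le> exp 1 \<le> 3\<close>.\<close>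

lemma power_self_le_fact: "real k ^ k \<le> 3 ^ k * fact k"
proof (induction k)
  case (Suc k)
  have "real (Suc k) ^ k \<le> 3 * real k ^ k"
  proof (cases "k = 0")
    case False
    have "real (Suc k) ^ k = real k ^ k * (1 + 1 / k) ^ k"
      using False by (simp add: field_simps flip: power_mult_distrib)
    also have "\<dots> \<le> real k ^ k * exp (1 / k) ^ k"
      by (intro mult_left_mono power_mono) auto
    also have "exp (1 / k) ^ k = exp 1" using False by (simp flip: exp_of_nat_mult)
    also have "real k ^ k * exp 1 \<le> real k ^ k * 3" using exp_le by (intro mult_left_mono) auto
    finally show ?thesis by simp
  qed simp
  also have "\<dots> \<le> 3 * (3 ^ k * fact k)" using Suc by simp
  finally have "real (Suc k) * real (Suc k) ^ k \<le> real (Suc k) * (3 * (3 ^ k * fact k))"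
    by (rule mult_left_mono) simp
  then show ?case by (simp add: algebra_simps)
qed simp

lemma binomial_le_power:
  assumes "k > 0"
  shows "real (n choose k) \<le> (3 * n / k) ^ k"
proof -
  have "real (n choose k) * fact k \<le> real n ^ k"
    using binomial_fact_pow[of n k] by (metis of_nat_fact of_nat_le_iff of_nat_mult of_nat_power)
  moreover have "real (n choose k) * real k ^ k \<le> real (n choose k) * (3 ^ k * fact k)"
    using power_self_le_fact by (intro mult_left_mono) auto
  ultimately have "real (n choose k) * real k ^ k \<le> 3 ^ k * real n ^ k"
    by (smt (verit) mult.left_commute mult_left_mono zero_le_power)
  then show ?thesis using assms by (simp add: power_divide power_mult_distrib pos_le_divide_eq)
qed

lemma sum_geometric_linear: "(\<Sum>u=1..N. real u * (1 / 2) ^ (u - 1)) \<le> 4"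
proof -
  have "(\<Sum>u=1..N. real u * (1 / 2) ^ (u - 1)) = 4 - (2 * real N + 4) / 2 ^ N"
  proof (induction N)
    case (Suc N)
    have "4 - (2 * real N + 4) / 2 ^ N + real (Suc N) * (1 / 2) ^ N = 4 - (2 * real (Suc N) + 4) / 2 ^ Suc N"
      by (simp add: power_one_over field_simps)
    moreover have "(\<Sum>u=1..Suc N. real u * (1 / 2 :: real) ^ (u - 1)) =
      (\<Sum>u=1..N. real u * (1 / 2) ^ (u - 1)) + real (Suc N) * (1 / 2) ^ N" by simp
    ultimately show ?case using Suc by presburger
  qed simp
  then show ?thesis by simp
qed

text \<open>With \<open>t\<close> proportional to \<open>d\<close> the threshold \<open>2 t\<close> exceeds the expected density of sets of size at
  most \<open>\<sigma> n / 4\<close> by a constant factor, so that \<open>t\<close> large makes dense small sets unlikely.\<close>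

lemma small_sets_sparse:
  fixes \<sigma> :: real and V :: "'a set"
  assumes V: "finite V" and \<sigma>: "0 < \<sigma>" "\<sigma> \<le> 1 / 2" and d: "d > 0" and n: "16 * d + 32 \<le> card V"
    and t: "\<sigma> * d \<le> 2 * t" "t \<le> \<sigma> * d" "t \<ge> 2" "6 / \<sigma> * (1 / 2) ^ (t - 2) \<le> 1"
  shows "card {E \<in> reg V d. \<exists>U\<subseteq>V. card U \<le> \<sigma> / 4 * card V \<and> 2 * t * card U < card (E \<inter> pairs U)}
    \<le> 8 / (\<sigma> * card V) * card (reg V d)" (is "real (card ?Bad) \<le> _")
proof -
  define n where "n = real (card V)"
  define R where "R = real (card (reg V d))"
  define Us where "Us u = {U. U \<subseteq> V \<and> card U = u}" for u
  \<comment> \<open>The trivial condition on \<open>{}\<close> matches \<open>tail_count\<close>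
    with an empty \<Gamma>.\<close>
  define bad where "bad U = {E \<in> reg V d. {} \<subseteq> E \<and> real (2 * t * card U) \<le> card (E \<inter> pairs U)}" for U
  define k where "k = nat \<lfloor>\<sigma> / 4 * n\<rfloor>"
  \<comment> \<open>The factor 2 is affordable here and only asks for a switching denominator of at
    least \<open>n * d / 2\<close>.\<close>
  define p where "p = 2 * real d / n"
  have d1: "real d \<ge> 1" using d by simp
  have nn: "n \<ge> 16 * real d + 32" unfolding n_def using \<open>16 * d + 32 \<le> card V\<close> by linarith
  then have n0: "n > 0" using d1 by linarith
  have p0: "p \<ge> 0" unfolding p_def using n0 by simp
  have fUs: "finite (Us u)" for u unfolding Us_def using V by auto
  have fbad: "finite (bad U)" for U unfolding bad_def using finite_reg[OF V] by auto
  have sub: "?Bad \<subseteq> (\<Union>u\<in>{1..k}. \<Union>U\<in>Us u. bad U)"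
  proof
    fix E assume "E \<in> ?Bad"
    then obtain U where U: "E \<in> reg V d" "U \<subseteq> V" "card U \<le> \<sigma> / 4 * n" "2 * t * card U < card (E \<inter> pairs U)"
      unfolding n_def by blast
    have "card U \<noteq> 0"
    proof
      assume "card U = 0"
      then have "U = {}" using U(2) V finite_subset by fastforce
      then have "pairs U = {}" unfolding pairs_def by auto
      then show False using U(4) by simp
    qed
    moreover have "card U \<le> k" unfolding k_def using U(3) by (simp add: le_nat_iff le_floor_iff)
    moreover have "real (2 * t * card U) \<le> real (card (E \<inter> pairs U))"
      using U(4) by (simp only: of_nat_le_iff)
    then have "E \<in> bad U" unfolding bad_def using U(1) by blast
    moreover have "U \<in> Us (card U)" unfolding Us_def using U(2) by blast
    ultimately have "card U \<in> {1..k}" "U \<in> Us (card U)" "E \<in> bad U" by auto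
    then show "E \<in> (\<Union>u\<in>{1..k}. \<Union>U\<in>Us u. bad U)" by blast
  qed
  have main: "card (Us u) * (x * R) \<le> 2 / (\<sigma> * n) * R * (u * (1 / 2) ^ (u - 1)) \<and>
      (\<forall>U\<in>Us u. card (bad U) \<le> x * R)"
    if u: "u \<in> {1..k}" and x: "x = (2 * u / (\<sigma> * n)) ^ (t * u)" for u x
  proof -
    define y where "y = 2 * u / (\<sigma> * n)"
    have u0: "u > 0" using u by simp
    have un: "u \<le> \<sigma> / 4 * n"
    proof -
      have "real k \<le> \<sigma> / 4 * n" unfolding k_def using \<sigma> n0 by (intro of_nat_floor) simp
      then show ?thesis using u by simp
    qed
    have y: "0 < y" "y \<le> 1 / 2" unfolding y_def using u0 un \<sigma> n0 by (auto simp: field_simps)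
    have "card (bad U) \<le> y ^ (t * u) * R" if U: "U \<in> Us u" for U
    proof -
      have fU: "finite U" and cU: "card U = u" using U V finite_subset unfolding Us_def by auto
      have tun: "t * u \<le> n * d / 8"
      proof -
        have "t * u \<le> (\<sigma> * d) * (\<sigma> / 4 * n)" using t(2) un \<sigma> unfolding of_nat_mult by (intro mult_mono) auto
        also have "\<dots> = (\<sigma> * \<sigma>) / 4 * (n * d)" by simp
        also have "\<dots> \<le> (1 / 2 * (1 / 2)) / 4 * (n * d)"
          using \<sigma> n0 by (intro mult_right_mono divide_right_mono mult_mono) auto
        also have "\<dots> \<le> n * d / 8" using n0 by simp
        finally show ?thesis .
      qed
      have "8 * real d ^ 2 + 16 * real d \<le> n * d / 2"
        using mult_right_mono[OF nn, of "real d"] by (simp add: algebra_simps power2_eq_square)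
      moreover have nd: "n * d > 0" using n0 d1 by simp
      ultimately have C: "n * d / 2 \<le> n * d - 2 * real (t * u) - (2 * real d ^ 2 + 4 * real d)"
        using tun by linarith
      have "real (card (bad U)) \<le> (card (pairs U) * p / (real (2 * t * card U) - real (t * u))) ^ (t * u) *
          p ^ card ({} :: 'a set set) * card (reg V d)"
        unfolding bad_def
      proof (rule tail_count[OF V])
        show "real (t * u) + real (card ({} :: 'a set set)) \<le> real (t * u)" by simp
        show "real (t * u) < real (2 * t * card U)" using u0 t cU by simp
        have "real d ^ 2 = p * (n * d / 2)" unfolding p_def using n0 by (simp add: power2_eq_square)
        also have "\<dots> \<le> p * (n * d - 2 * real (t * u) - (2 * real d ^ 2 + 4 * real d))" using C p0 by (rule mult_left_mono)
        finally show "real d ^ 2 \<le> p * (real (card V) * real d - 2 * real (t * u) - (2 * real d ^ 2 + 4 * real d))"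
          unfolding n_def by simp
        show "real (card V) * real d - 2 * real (t * u) - (2 * real d ^ 2 + 4 * real d) > 0"
          using C nd unfolding n_def by linarith
      qed (use fU finite_pairs p0 in auto)
      \<comment> \<open>With threshold \<open>2 * t * u\<close> and moment order
        \<open>t * u\<close>, the denominator \<open>K - m\<close> becomes
        \<open>t * u\<close>.\<close>
      also have "\<dots> = (card (pairs U) * p / (t * u)) ^ (t * u) * R" unfolding cU R_def by simp
      also have "\<dots> \<le> y ^ (t * u) * R"
      proof (intro mult_right_mono power_mono)
        have "card (pairs U) * p / (t * u) \<le> u ^ 2 / 2 * p / (t * u)"
          using card_pairs_le[OF fU] p0 unfolding cU by (intro divide_right_mono mult_right_mono) auto
        also have "\<dots> = u * d / (n * t)" unfolding p_def using u0 n0 t by (simp add: field_simps power2_eq_square)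
        also have "\<dots> \<le> y"
        proof -
          have "t > 0" using t by simp
          moreover have "(u * n) * (\<sigma> * d) \<le> (u * n) * (2 * t)" using t(1) n0 by (intro mult_left_mono) auto
          ultimately show ?thesis unfolding y_def using n0 \<sigma> by (simp add: field_simps)
        qed
        finally show "card (pairs U) * p / (t * u) \<le> y" .
      qed (use p0 in \<open>auto simp: R_def\<close>)
      finally show ?thesis .
    qed
    moreover have "card (Us u) * y ^ (t * u) \<le> y * (1 / 2) ^ (u - 1)"
    proof -
      have "card (Us u) = card V choose u" unfolding Us_def using n_subsets[OF V] by simp
      then have "real (card (Us u)) \<le> (3 * n / u) ^ u" unfolding n_def using binomial_le_power[OF u0] by simp
      then have "card (Us u) * y ^ (t * u) \<le> (3 * n / u) ^ u * y ^ (t * u)"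
        using y by (intro mult_right_mono) auto
      also have "\<dots> = (3 * n / u * y ^ t) ^ u" unfolding power_mult by (rule power_mult_distrib[symmetric])
      also have "\<dots> \<le> y ^ u"
      proof (rule power_mono)
        \<comment> \<open>One factor \<open>y\<close> reduces the \<open>3 * n / u\<close> from the
          choice of \<open>U\<close> to \<open>6 / \<sigma>\<close>, the last \<open>t - 2\<close>
          factors absorb this constant, and one \<open>y\<close> is left over.\<close>
        have "y ^ t = y * y * y ^ (t - 2)"
          using t(3) by (metis add_diff_inverse_nat mult.assoc not_less power2_eq_square power_add)
        also have "\<dots> \<le> y * y * (1 / 2) ^ (t - 2)" using y by (intro mult_left_mono power_mono) auto
        finally have "3 * n / u * y ^ t \<le> 3 * n / u * (y * y * (1 / 2) ^ (t - 2))"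
          using n0 by (intro mult_left_mono) auto
        also have "\<dots> = y * ((3 * n / u * y) * (1 / 2) ^ (t - 2))" by (simp only: mult_ac)
        also have "3 * n / u * y = 6 / \<sigma>" unfolding y_def using u0 n0 \<sigma> by simp
        also have "y * (6 / \<sigma> * (1 / 2) ^ (t - 2)) \<le> y * 1" using t(4) y by (intro mult_left_mono) auto
        finally show "3 * n / u * y ^ t \<le> y" by simp
      qed (use y n0 in auto)
      \<comment> \<open>One \<open>y\<close> keeps the decay in \<open>n\<close>; bounding the
        others by \<open>1 / 2\<close> makes the sum over \<open>u\<close> converge.\<close>
      also have "y ^ u = y * y ^ (u - 1)" using u0 by (cases u) auto
      also have "\<dots> \<le> y * (1 / 2) ^ (u - 1)" using y by (intro mult_left_mono power_mono) auto
      finally show ?thesis .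
    qed
    then have "card (Us u) * y ^ (t * u) * R \<le> y * (1 / 2) ^ (u - 1) * R"
      by (rule mult_right_mono) (simp add: R_def)
    ultimately show ?thesis unfolding x y_def by (simp add: mult_ac)
  qed
  have "card ?Bad \<le> card (\<Union>u\<in>{1..k}. \<Union>U\<in>Us u. bad U)"
    using sub fUs fbad by (intro card_mono) auto
  also have "\<dots> \<le> (\<Sum>u\<in>{1..k}. card (\<Union>U\<in>Us u. bad U))" by (rule card_UN_le) simp
  also have "\<dots> \<le> (\<Sum>u\<in>{1..k}. \<Sum>U\<in>Us u. card (bad U))" by (intro sum_mono card_UN_le fUs)
  finally have "card ?Bad \<le> (\<Sum>u\<in>{1..k}. \<Sum>U\<in>Us u. card (bad U))" .
  then have "real (card ?Bad) \<le> real (\<Sum>u\<in>{1..k}. \<Sum>U\<in>Us u. card (bad U))" by (rule of_nat_mono)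
  also have "\<dots> = (\<Sum>u\<in>{1..k}. \<Sum>U\<in>Us u. real (card (bad U)))" by (simp only: of_nat_sum)
  also have "\<dots> \<le> (\<Sum>u\<in>{1..k}. 2 / (\<sigma> * n) * R * (u * (1 / 2) ^ (u - 1)))"
  proof (rule sum_mono)
    fix u assume u: "u \<in> {1..k}"
    let ?x = "(2 * real u / (\<sigma> * n)) ^ (t * u)"
    have "(\<Sum>U\<in>Us u. real (card (bad U))) \<le> (\<Sum>U\<in>Us u. ?x * R)"
      using main[OF u refl] by (intro sum_mono) blast
    then show "(\<Sum>U\<in>Us u. real (card (bad U))) \<le> 2 / (\<sigma> * n) * R * (u * (1 / 2) ^ (u - 1))"
      using main[OF u refl] by simp
  qed
  also have "\<dots> = 2 / (\<sigma> * n) * R * (\<Sum>u=1..k. u * (1 / 2) ^ (u - 1))"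
    by (simp add: sum_distrib_left)
  also have "\<dots> \<le> 2 / (\<sigma> * n) * R * 4"
    using sum_geometric_linear n0 \<sigma> by (intro mult_left_mono) (auto simp: R_def)
  finally show ?thesis unfolding n_def R_def by simp
qed

section \<open>The random regular graph\<close>

text \<open>Circulant graphs exist, so that \<open>random_regular_graph\<close> is not a junk value.\<close>

lemma symmetric_residues:
  assumes "d < n" "even (d * n)"
  shows "\<exists>S\<subseteq>{1..<int n}. card S = d \<and> (\<forall>x\<in>S. int n - x \<in> S)"
proof -
  define k where "k = int (d div 2)"
  define S\<^sub>0 where "S\<^sub>0 = {1..k} \<union> {int n - k..int n - 1}"
  have k: "2 * k \<le> int d" "0 \<le> k" "2 * k < int n" unfolding k_def using assms(1) by linarith+
  have card: "card S\<^sub>0 = 2 * nat k"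
    unfolding S\<^sub>0_def using k by (subst card_Un_disjoint) auto
  have sym: "\<forall>x\<in>S\<^sub>0. int n - x \<in> S\<^sub>0" unfolding S\<^sub>0_def by auto
  have sub: "S\<^sub>0 \<subseteq> {1..<int n}" unfolding S\<^sub>0_def using k by auto
  show ?thesis
  proof (cases "even d")
    case True
    then have "2 * nat k = d" unfolding k_def by simp
    then show ?thesis using card sym sub by (intro exI[of _ S\<^sub>0]) simp
  next
    case False
    \<comment> \<open>For odd \<open>d\<close> the number of vertices is even, and the residue
      \<open>n / 2\<close> is its own negative, so it can be added alone.\<close>
    then obtain h where h: "n = 2 * h" using assms(2) by (auto elim: evenE)
    have dk: "d = 2 * nat k + 1" unfolding k_def using False by (simp add: odd_two_times_div_two_succ)
    then have kh: "k < int h" using assms(1) h k by linarith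
    have "int h \<notin> S\<^sub>0" unfolding S\<^sub>0_def using kh h by auto
    moreover have "finite S\<^sub>0" unfolding S\<^sub>0_def by simp
    ultimately have "card (insert (int h) S\<^sub>0) = d" using card dk by simp
    moreover have "insert (int h) S\<^sub>0 \<subseteq> {1..<int n}" using sub kh k h by auto
    moreover have "\<forall>x\<in>insert (int h) S\<^sub>0. int n - x \<in> insert (int h) S\<^sub>0" using sym h by auto
    ultimately show ?thesis by blast
  qed
qed

text \<open>Join \<open>v\<close> and \<open>w\<close> when their difference modulo \<open>n\<close>
  lies in the symmetric set \<open>S\<close>. For fixed \<open>v\<close> these differences run
  through every residue once, so each degree is \<open>card S\<close>.\<close>

lemma reg_nonempty:
  assumes "d < n" "even (d * n)"
  shows "reg {1..n} d \<noteq> {}"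
proof -
  obtain S where S: "S \<subseteq> {1..<int n}" "card S = d" "\<And>x. x \<in> S \<Longrightarrow> int n - x \<in> S"
    using symmetric_residues[OF assms] by blast
  define f where "f v w = (int w - int v) mod int n" for v w :: nat
  have n0: "n > 0" using assms by simp
  have neg: "f w v \<in> S" if "f v w \<in> S" for v w
  proof -
    have "f v w \<noteq> 0" using that S(1) by auto
    moreover have "f w v = (- (int w - int v)) mod int n" unfolding f_def by simp
    ultimately have "f w v = int n - f v w" unfolding f_def by (metis zmod_zminus1_eq_if)
    then show ?thesis using S(3)[OF that] by simp
  qed
  define E where "E = {{v, w} | v w. v \<in> {1..n} \<and> w \<in> {1..n} \<and> f v w \<in> S}"
  have EV: "E \<subseteq> pairs {1..n}"
  proof
    fix e assume "e \<in> E"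
    then obtain v w where e: "e = {v, w}" "v \<in> {1..n}" "w \<in> {1..n}" "f v w \<in> S" unfolding E_def by blast
    moreover have "v \<noteq> w" using e(4) S(1) unfolding f_def by auto
    ultimately show "e \<in> pairs {1..n}" by simp
  qed
  have "card (nbrs E v) = d" if v: "v \<in> {1..n}" for v
  proof -
    have nb: "nbrs E v = {w \<in> {1..n}. f v w \<in> S}"
      unfolding nbrs_def E_def using neg v by (auto simp: doubleton_eq_iff)
    have inj: "inj_on (f v) {1..n}"
    proof (rule inj_onI)
      fix w w' assume w: "w \<in> {1..n}" "w' \<in> {1..n}" "f v w = f v w'"
      then have "int n dvd (int w - int v) - (int w' - int v)" unfolding f_def by (simp add: mod_eq_dvd_iff)
      then have dvd: "int n dvd int w - int w'" by simp
      have "\<bar>int w - int w'\<bar> < int n" using w by auto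
      then have "int w - int w' = 0" using dvd by (metis abs_of_nat dvd_imp_le_int not_less)
      then show "w = w'" by simp
    qed
    have "f v ` {1..n} \<subseteq> {0..<int n}" unfolding f_def using n0 by auto
    moreover have "card (f v ` {1..n}) = card {0..<int n}" using inj by (simp add: card_image)
    ultimately have img: "f v ` {1..n} = {0..<int n}" by (intro card_subset_eq) auto
    have "f v ` nbrs E v = S"
    proof
      show "S \<subseteq> f v ` nbrs E v"
      proof
        fix x assume x: "x \<in> S"
        then have "x \<in> f v ` {1..n}" unfolding img using S(1) by auto
        then show "x \<in> f v ` nbrs E v" unfolding nb using x by auto
      qed
    qed (auto simp: nb)
    moreover have "inj_on (f v) (nbrs E v)" unfolding nb by (rule inj_on_subset[OF inj]) auto
    then have "card (f v ` nbrs E v) = card (nbrs E v)" by (rule card_image)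
    ultimately show ?thesis using S(2) by simp
  qed
  then have "E \<in> reg {1..n} d" using EV unfolding reg_def by blast
  then show ?thesis by blast
qed

lemma degree_conv_nbrs: "edges G \<subseteq> pairs V \<Longrightarrow> degree G v = card (nbrs (edges G) v)"
  unfolding degree_def by (simp add: card_nbrs)

lemma regular_graphs_conv_reg: "regular_graphs n d = UGraph {1..n} ` reg {1..n} d"
proof (intro equalityI subsetI)
  fix G assume G: "G \<in> regular_graphs n d"
  then have E: "edges G \<subseteq> pairs {1..n}" and V: "verts G = {1..n}"
    unfolding regular_graphs_def simple_graph_def pairs_def by auto
  have "edges G \<in> reg {1..n} d"
    using G E V degree_conv_nbrs[OF E] unfolding reg_def regular_graphs_def regular_def by auto
  moreover have "G = UGraph {1..n} (edges G)" using V by (metis ugraph.collapse)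
  ultimately show "G \<in> UGraph {1..n} ` reg {1..n} d" by blast
next
  fix G assume "G \<in> UGraph {1..n} ` reg {1..n} d"
  then obtain E where E: "E \<in> reg {1..n} d" "G = UGraph {1..n} E" by blast
  have EV: "edges G \<subseteq> pairs {1..n}" using regD(1)[OF E(1)] E(2) by simp
  then show "G \<in> regular_graphs n d"
    using E regD(2)[OF E(1)] degree_conv_nbrs[OF EV]
    unfolding regular_graphs_def simple_graph_def regular_def by (auto simp: pairs_def)
qed

lemma card_cross:
  assumes "finite A" "finite B" "A \<inter> B = {}"
  shows "card (cross A B) = card A * card B"
proof -
  have "cross A B = (\<lambda>(a, b). {a, b}) ` (A \<times> B)" unfolding cross_def by auto
  moreover have "inj_on (\<lambda>(a, b). {a, b}) (A \<times> B)"
    using assms(3) by (auto simp: inj_on_def doubleton_eq_iff)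
  ultimately show ?thesis by (simp add: card_image card_cartesian_product)
qed

section \<open>Constants and the final probability estimate\<close>

text \<open>The logarithmic condition says that the entropy of choosing \<Gamma> stays below the
  exponent gained in \<open>edge_concentration\<close>.\<close>

lemma sparsity_constant_exists:
  fixes \<delta> :: real
  assumes "0 < \<delta>" "\<delta> \<le> 1"
  shows "\<exists>\<kappa>. 0 < \<kappa> \<and> \<kappa> \<le> \<delta> / 8 \<and> \<kappa> * ln (200 / \<delta>\<^sup>2) \<le> \<delta>\<^sup>2 / 200"
proof -
  have "\<delta>\<^sup>2 \<le> 1" using assms by (intro power_le_one) auto
  then have L: "ln (200 / \<delta>\<^sup>2) > 0" using assms by (intro ln_gt_zero) (simp add: field_simps)
  define \<kappa> where "\<kappa> = min (\<delta> / 8) (\<delta>\<^sup>2 / 200 / ln (200 / \<delta>\<^sup>2))"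
  have "\<kappa> * ln (200 / \<delta>\<^sup>2) \<le> \<delta>\<^sup>2 / 200 / ln (200 / \<delta>\<^sup>2) * ln (200 / \<delta>\<^sup>2)"
    unfolding \<kappa>_def using L by (intro mult_right_mono) auto
  also have "\<dots> = \<delta>\<^sup>2 / 200" using L by simp
  finally have "\<kappa> * ln (200 / \<delta>\<^sup>2) \<le> \<delta>\<^sup>2 / 200" .
  moreover have "0 < \<kappa>" unfolding \<kappa>_def using assms L by simp
  moreover have "\<kappa> \<le> \<delta> / 8" unfolding \<kappa>_def by simp
  ultimately show ?thesis by blast
qed

text \<open>One bad event for each clause of \<open>typical\<close>. Cuts use
  \<open>edge_concentration\<close> with an empty \<Gamma>, at most \<open>4 ^ card V\<close>
  indices and deviation \<open>\<alpha> / 100\<close>; boosters use a single index, a set depending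
  on \<Gamma>, and deviation \<open>1 / 200\<close>. The choice of \<alpha> turns
  \<open>3 * \<alpha>\<close> into \<open>\<sigma> / 4\<close>.\<close>

lemma atypical_count:
  fixes \<sigma> \<kappa> \<kappa>' \<alpha> :: real
  assumes V: "finite V" "V \<noteq> {}" and d: "d > 0"
    and \<sigma>: "0 < \<sigma>" "\<sigma> \<le> 1 / 2" and \<alpha>: "\<alpha> = \<sigma> / 12"
    and t: "\<sigma> * d \<le> 2 * t" "t \<le> \<sigma> * d" "t \<ge> 2" "6 / \<sigma> * (1 / 2) ^ (t - 2) \<le> 1"
    and \<kappa>: "0 < \<kappa>" "\<kappa> \<le> 1 / 200 / 8" "\<kappa> * ln (200 / (1 / 200)\<^sup>2) \<le> (1 / 200)\<^sup>2 / 200"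
    and \<kappa>': "0 < \<kappa>'" "\<kappa>' \<le> \<alpha> / 100 / 8" "\<kappa>' * ln (200 / (\<alpha> / 100)\<^sup>2) \<le> (\<alpha> / 100)\<^sup>2 / 200"
    and n: "16 * d + 32 \<le> card V" "8 * real d + 16 \<le> 1 / 200 * card V" "8 * real d + 16 \<le> \<alpha> / 100 * card V"
  shows "card {E \<in> reg V d. \<not> typical V d (2 * t) \<alpha> \<kappa> E} \<le>
    (8 / (\<sigma> * card V) + 4 ^ card V * exp (- ((\<alpha> / 100)\<^sup>2 / 200 * (real (card V) * real d)))
      + exp (- ((1 / 200)\<^sup>2 / 200 * (real (card V) * real d)))) * card (reg V d)"
    (is "real (card ?Bad) \<le> _")
proof -
  let ?n = "real (card V)"
  define B1 where "B1 = {E \<in> reg V d. \<exists>U\<subseteq>V. card U \<le> \<sigma> / 4 * card V \<and> 2 * t * card U < card (E \<inter> pairs U)}"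
  \<comment> \<open>The index set contains pairs that are not disjoint, for which
    \<open>cross A B\<close> has singletons.\<close>
  define \<Phi> where "\<Phi> = (\<lambda>(A, B) (\<Gamma> :: 'a set set). cross A B \<inter> pairs V)"
  define B2 where "B2 = {E \<in> reg V d. \<exists>i\<in>Pow V \<times> Pow V. \<exists>\<Gamma>\<subseteq>E. card \<Gamma> \<le> \<kappa>' * (?n * real d) \<and>
      real (card (E \<inter> \<Phi> i \<Gamma>)) < real (card (\<Phi> i \<Gamma>)) * real d / ?n - 2 * (\<alpha> / 100) * (?n * real d)}"
  define B3 where "B3 = {E \<in> reg V d. \<exists>i\<in>{()}. \<exists>\<Gamma>\<subseteq>E. card \<Gamma> \<le> \<kappa> * (?n * real d) \<and>
      real (card (E \<inter> boosters V \<Gamma>)) < real (card (boosters V \<Gamma>)) * real d / ?n - 2 * (1 / 200) * (?n * real d)}"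
  have fR: "finite (reg V d)" using finite_reg[OF V(1)] .
  have sub: "?Bad \<subseteq> B1 \<union> B2 \<union> B3"
  proof
    fix E assume E: "E \<in> ?Bad"
    then have R: "E \<in> reg V d" by blast
    have EV: "E \<subseteq> pairs V" using regD(1)[OF R] .
    from E have "\<not> typical V d (2 * t) \<alpha> \<kappa> E" by blast
    then consider
      (small) U where "U \<subseteq> V" "real (card U) \<le> 3 * \<alpha> * ?n" "\<not> card (E \<inter> pairs U) \<le> 2 * t * card U"
    | (cut) A B where "A \<subseteq> V" "B \<subseteq> V" "A \<inter> B = {}"
        "\<not> real (card A) * real (card B) * real d / ?n - \<alpha> / 50 * (?n * real d) \<le> real (card (E \<inter> cross A B))"
    | (boost) \<Gamma> where "\<Gamma> \<subseteq> E" "real (card \<Gamma>) \<le> \<kappa> * (?n * real d)"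
        "\<not> real (card (boosters V \<Gamma>)) * real d / ?n - ?n * real d / 100 \<le> real (card (E \<inter> boosters V \<Gamma>))"
      unfolding typical_def by blast
    then show "E \<in> B1 \<union> B2 \<union> B3"
    proof cases
      case small
      then have "real (card U) \<le> \<sigma> / 4 * ?n" "2 * t * card U < card (E \<inter> pairs U)" using \<alpha> by auto
      then show ?thesis using R small(1) unfolding B1_def by blast
    next
      case cut
      have "cross A B \<subseteq> pairs V" unfolding cross_def using cut by auto
      then have \<Phi>: "\<Phi> (A, B) {} = cross A B" unfolding \<Phi>_def by auto
      have "card (cross A B) = card A * card B"
        using cut V(1) by (intro card_cross) (auto intro: finite_subset)
      then have "real (card (E \<inter> \<Phi> (A, B) {})) < real (card (\<Phi> (A, B) {})) * real d / ?n - 2 * (\<alpha> / 100) * (?n * real d)"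
        unfolding \<Phi> using cut(4) by simp
      moreover have "real (card ({} :: 'a set set)) \<le> \<kappa>' * (?n * real d)" using \<kappa>' by simp
      moreover have "(A, B) \<in> Pow V \<times> Pow V" using cut by blast
      ultimately have "E \<in> B2" using R unfolding B2_def by blast
      then show ?thesis by blast
    next
      case boost
      then have "real (card (E \<inter> boosters V \<Gamma>)) < real (card (boosters V \<Gamma>)) * real d / ?n - 2 * (1 / 200) * (?n * real d)"
        by simp
      then have "E \<in> B3" using R boost(1,2) unfolding B3_def by blast
      then show ?thesis by blast
    qed
  qed
  have c1: "real (card B1) \<le> 8 / (\<sigma> * card V) * card (reg V d)"
    unfolding B1_def by (rule small_sets_sparse[OF V(1) \<sigma> d n(1) t])
  have c2: "real (card B2) \<le> card (Pow V \<times> Pow V) * exp (- ((\<alpha> / 100)\<^sup>2 / 200 * (?n * real d))) * card (reg V d)"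
    unfolding B2_def
    by (rule edge_concentration[OF V(1) _ _ \<kappa>' d n(3)]) (use \<alpha> \<sigma> V(1) in \<open>auto simp: \<Phi>_def\<close>)
  have c3: "real (card B3) \<le> card {()} * exp (- ((1 / 200)\<^sup>2 / 200 * (?n * real d))) * card (reg V d)"
    unfolding B3_def
    by (rule edge_concentration[OF V(1) _ _ \<kappa> d n(2)]) (auto simp: boosters_subset)
  have "card (Pow V \<times> Pow V) = 4 ^ card V"
    using V(1) by (simp add: card_cartesian_product card_Pow flip: power_mult_distrib)
  then have c2': "real (card B2) \<le> 4 ^ card V * exp (- ((\<alpha> / 100)\<^sup>2 / 200 * (?n * real d))) * card (reg V d)"
    using c2 by simp
  have "card ?Bad \<le> card (B1 \<union> B2 \<union> B3)"
    using sub fR unfolding B1_def B2_def B3_def by (intro card_mono) auto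
  also have "\<dots> \<le> card B1 + card B2 + card B3" by (meson add_mono card_Un_le le_trans order_refl)
  finally have "real (card ?Bad) \<le> real (card B1) + real (card B2) + real (card B3)" by linarith
  then show ?thesis using c1 c2' c3 by (simp add: distrib_right)
qed

text \<open>Apply \<open>typical_resilient\<close> to a subgraph attaining the minimum in the
  resilience; if its maximum degree were at most \<open>d / 6\<close>, its removal would leave a
  Hamilton cycle.\<close>

lemma typical_local_resilience:
  assumes V: "finite V" "card V \<ge> 400" and d: "d > 0" and s: "s > 0" "42 * s \<le> 5 * d"
    and \<alpha>: "\<alpha> > 0" "\<alpha> \<le> 1" and E: "E \<in> reg V d"
    and typ_E: "typical V d s \<alpha> \<kappa> E" and M: "4 ^ card V * (1 - \<alpha> / 25) ^ M < 1"
    and size: "card V * (7 * s) + M + card V + 1 \<le> \<kappa> * (real (card V) * real d)"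
  shows "d < 6 * local_resilience (UGraph V E) HAM"
proof (rule ccontr)
  let ?G = "UGraph V E"
  assume small: "\<not> ?thesis"
  obtain H where H: "spanning_subgraph H ?G" "max_degree H = local_resilience ?G HAM"
    "delete_edges ?G H \<notin> HAM" using local_resilience_HAM_attained by blast
  have EV: "E \<subseteq> pairs V" and deg: "\<And>v. v \<in> V \<Longrightarrow> card (nbrs E v) = d" using regD[OF E] by auto
  have HE: "edges H \<subseteq> E" "verts H = V" using H(1) unfolding spanning_subgraph_def by auto
  have HV: "edges H \<subseteq> pairs V" using HE EV by blast
  have "6 * card (nbrs (edges H) v) \<le> d" if "v \<in> V" for v
  proof -
    have "degree H v \<le> max_degree H"
      unfolding max_degree_def using HE(2) V(1) that by (intro Max_ge) auto
    then show ?thesis using degree_conv_nbrs[OF HV, of v] H(2) small by linarith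
  qed
  then have "hamiltonian V (E - edges H)"
    using typical_resilient[OF V d s \<alpha> EV deg typ_E HE(1) _ M size] by blast
  moreover have "simple_graph (UGraph V (E - edges H))"
    using V(1) EV unfolding simple_graph_def pairs_def by auto
  ultimately have "delete_edges ?G H \<in> HAM"
    unfolding HAM_def hamiltonian_def delete_edges_def by simp
  then show False using H(3) by blast
qed

text \<open>The order of choice matters: \<kappa> from the booster deviation, then \<sigma> small
  enough that the minimum-degree edges fit into a quarter of the budget \<kappa>, and last
  \<open>\<kappa>'\<close> from the cut deviation, which depends on \<sigma>.\<close>

lemma resilience_constants:
  "\<exists>\<sigma> \<kappa> \<kappa>' :: real. 0 < \<sigma> \<and> \<sigma> \<le> 1 / 84 \<and> 14 * \<sigma> \<le> \<kappa> / 4 \<and>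
    0 < \<kappa> \<and> \<kappa> \<le> 1 / 200 / 8 \<and> \<kappa> * ln (200 / (1 / 200)\<^sup>2) \<le> (1 / 200)\<^sup>2 / 200 \<and>
    0 < \<kappa>' \<and> \<kappa>' \<le> \<sigma> / 12 / 100 / 8 \<and> \<kappa>' * ln (200 / (\<sigma> / 12 / 100)\<^sup>2) \<le> (\<sigma> / 12 / 100)\<^sup>2 / 200"
proof -
  obtain \<kappa> :: real where \<kappa>: "0 < \<kappa>" "\<kappa> \<le> 1 / 200 / 8" "\<kappa> * ln (200 / (1 / 200)\<^sup>2) \<le> (1 / 200)\<^sup>2 / 200"
    using sparsity_constant_exists[of "1 / 200"] by auto
  define \<sigma> where "\<sigma> = \<kappa> / 56"
  have \<sigma>: "0 < \<sigma>" "\<sigma> \<le> 1 / 84" "14 * \<sigma> \<le> \<kappa> / 4" unfolding \<sigma>_def using \<kappa> by auto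
  obtain \<kappa>' where "0 < \<kappa>'" "\<kappa>' \<le> \<sigma> / 12 / 100 / 8" "\<kappa>' * ln (200 / (\<sigma> / 12 / 100)\<^sup>2) \<le> (\<sigma> / 12 / 100)\<^sup>2 / 200"
    using sparsity_constant_exists[of "\<sigma> / 12 / 100"] \<sigma> by auto
  then show ?thesis using \<sigma> \<kappa> by blast
qed

lemma four_exp_bound: "4 ^ n * exp (- (4 * real n)) \<le> (4 / 5) ^ n"
proof -
  have "(5 :: real) \<le> exp 4" using exp_ge_add_one_self[of "4 :: real"] by simp
  then have "exp (- 4) \<le> (1 / 5 :: real)" by (simp add: exp_minus field_simps)
  then have "(4 * exp (- 4)) ^ n \<le> (4 * (1 / 5) :: real) ^ n" by (intro power_mono mult_left_mono) auto
  moreover have "exp (- (4 * real n)) = exp (- 4) ^ n"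
    using exp_of_nat_mult[of n "- 4 :: real"] by (simp add: mult.commute)
  ultimately show ?thesis by (simp add: power_mult_distrib)
qed

text \<open>Bounding \<open>1 - \<theta>\<close> by an exponential reduces the claim to
  \<open>4 * exp (- 4) < 1\<close>.\<close>

lemma hitting_rounds:
  fixes \<theta> :: real
  assumes "0 \<le> \<theta>" "\<theta> \<le> 1" "4 * real n \<le> \<theta> * real M" "n > 0"
  shows "4 ^ n * (1 - \<theta>) ^ M < 1"
proof -
  have "(1 - \<theta>) ^ M \<le> exp (- \<theta>) ^ M"
    using assms exp_ge_add_one_self[of "- \<theta>"] by (intro power_mono) auto
  also have "\<dots> = exp (- (\<theta> * real M))"
    using exp_of_nat_mult[of M "- \<theta>"] by (simp add: mult.commute)
  also have "\<dots> \<le> exp (- (4 * real n))" using assms by simp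
  finally have "4 ^ n * (1 - \<theta>) ^ M \<le> 4 ^ n * exp (- (4 * real n))" by (intro mult_left_mono) auto
  also have "\<dots> \<le> (4 / 5) ^ n" by (rule four_exp_bound)
  also have "\<dots> < 1" using assms(4) by (simp add: power_less_one_iff)
  finally show ?thesis .
qed

lemma prob_resilience:
  fixes \<sigma> \<kappa> \<kappa>' :: real
  assumes c: "0 < \<sigma>" "\<sigma> \<le> 1 / 84" "14 * \<sigma> \<le> \<kappa> / 4"
      "0 < \<kappa>" "\<kappa> \<le> 1 / 200 / 8" "\<kappa> * ln (200 / (1 / 200)\<^sup>2) \<le> (1 / 200)\<^sup>2 / 200"
      "0 < \<kappa>'" "\<kappa>' \<le> \<sigma> / 12 / 100 / 8" "\<kappa>' * ln (200 / (\<sigma> / 12 / 100)\<^sup>2) \<le> (\<sigma> / 12 / 100)\<^sup>2 / 200"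
    and T: "(1 / 2) ^ T \<le> \<sigma> / 6" "real T + 3 \<le> \<sigma> * real d"
    and d: "8 \<le> \<kappa> * real d" "400 \<le> \<sigma> / 12 * \<kappa> * real d"
      "4 \<le> (\<sigma> / 12 / 100)\<^sup>2 / 200 * real d" "4 \<le> (1 / 200)\<^sup>2 / 200 * real d"
    and n: "400 \<le> n" "16 * d + 32 \<le> n" "8 * real d + 16 \<le> 1 / 200 * real n"
      "8 * real d + 16 \<le> \<sigma> / 12 / 100 * real n" "even (d * n)"
  shows "1 - (8 / (\<sigma> * real n) + 2 * (4 / 5) ^ n)
    \<le> measure_pmf.prob (random_regular_graph n d) {G. real d / 6 \<le> real (local_resilience G HAM)}"
proof -
  define V where "V = {1..n}"
  define t where "t = nat \<lfloor>\<sigma> * real d\<rfloor>"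
  \<comment> \<open>The budget \<open>\<kappa> * n * d\<close> is split: a quarter for the edges at
    each vertex, a quarter for the hitting set, and the remaining half, at least
    \<open>4 * n\<close>, for the boosters and the rounding in \<open>M\<close>.\<close>
  define M where "M = nat \<lceil>\<kappa> * (real n * real d) / 4\<rceil>"
  define R where "R = reg V d"
  define Bad where "Bad = {E \<in> R. \<not> typical V d (2 * t) (\<sigma> / 12) \<kappa> E}"
  have V: "finite V" "card V = n" "V \<noteq> {}" unfolding V_def using n(1) by auto
  have d0: "d > 0"
  proof (rule ccontr)
    assume "\<not> ?thesis"
    then show False using d(1) by simp
  qed
  have t: "\<sigma> * real d - 1 < real t" "real t \<le> \<sigma> * real d" unfolding t_def using T(2) by linarith+
  have t2: "\<sigma> * real d \<le> 2 * real t" "t \<ge> T + 2" using t T(2) by simp_all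
  have t3: "6 / \<sigma> * (1 / 2) ^ (t - 2) \<le> 1"
  proof -
    have "(1 / 2 :: real) ^ (t - 2) \<le> (1 / 2) ^ T" using t2(2) by (intro power_decreasing) auto
    then have "(1 / 2) ^ (t - 2) \<le> \<sigma> / 6" using T(1) by linarith
    then show ?thesis using c(1) by (simp add: field_simps)
  qed
  have dn: "d < n" using n(2) by linarith
  have N: "real n * real d > 0" using d0 n(1) by simp
  have R: "finite R" "R \<noteq> {}" unfolding R_def V_def using finite_reg reg_nonempty[OF dn n(5)] by auto
  have cR: "real (card R) > 0" using R by (simp add: card_gt_0_iff)
  have "real (card Bad) \<le> (8 / (\<sigma> * card V) + 4 ^ card V * exp (- ((\<sigma> / 12 / 100)\<^sup>2 / 200 * (real (card V) * real d)))
      + exp (- ((1 / 200)\<^sup>2 / 200 * (real (card V) * real d)))) * card (reg V d)"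
    unfolding Bad_def R_def
    by (rule atypical_count[OF V(1,3) d0 c(1) _ refl t2(1) t(2) _ t3 c(4-9)])
      (use c(2) t2(2) n V(2) in simp_all)
  also have "\<dots> \<le> (8 / (\<sigma> * real n) + 2 * (4 / 5) ^ n) * card R"
  proof -
    have "4 * real n \<le> (\<sigma> / 12 / 100)\<^sup>2 / 200 * (real n * real d)"
      using mult_right_mono[OF d(3), of "real n"] by (simp add: mult_ac)
    then have "exp (- ((\<sigma> / 12 / 100)\<^sup>2 / 200 * (real n * real d))) \<le> exp (- (4 * real n))"
      by (simp only: exp_le_cancel_iff neg_le_iff_le)
    then have "4 ^ n * exp (- ((\<sigma> / 12 / 100)\<^sup>2 / 200 * (real n * real d))) \<le> 4 ^ n * exp (- (4 * real n))"
      by (intro mult_left_mono) auto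
    moreover have "4 * real n \<le> (1 / 200)\<^sup>2 / 200 * (real n * real d)"
      using mult_right_mono[OF d(4), of "real n"] by (simp add: mult_ac)
    then have "exp (- ((1 / 200)\<^sup>2 / 200 * (real n * real d))) \<le> exp (- (4 * real n))"
      by (simp only: exp_le_cancel_iff neg_le_iff_le)
    moreover have "1 * exp (- (4 * real n)) \<le> 4 ^ n * exp (- (4 * real n))"
      by (intro mult_right_mono) auto
    ultimately have "8 / (\<sigma> * real n) + 4 ^ n * exp (- ((\<sigma> / 12 / 100)\<^sup>2 / 200 * (real n * real d)))
      + exp (- ((1 / 200)\<^sup>2 / 200 * (real n * real d))) \<le> 8 / (\<sigma> * real n) + 2 * (4 / 5) ^ n"
      using four_exp_bound[of n] by linarith
    then show ?thesis unfolding V(2) R_def by (intro mult_right_mono) auto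
  qed
  finally have bad: "real (card Bad) \<le> (8 / (\<sigma> * real n) + 2 * (4 / 5) ^ n) * card R" .
  have M: "\<kappa> * (real n * real d) / 4 \<le> real M" "real M \<le> \<kappa> * (real n * real d) / 4 + 1"
    unfolding M_def using c(4) N by (simp_all add: of_nat_ceiling)
  have rounds: "4 ^ card V * (1 - \<sigma> / 12 / 25) ^ M < 1"
  proof (rule hitting_rounds)
    have "400 * real n \<le> \<sigma> / 12 * \<kappa> * real d * real n" using d(2) by (rule mult_right_mono) simp
    then have "4 * real n \<le> \<sigma> / 12 / 25 * (\<kappa> * (real n * real d) / 4)" by (simp add: mult_ac)
    also have "\<dots> \<le> \<sigma> / 12 / 25 * real M" using M(1) c(1) by (intro mult_left_mono) auto
    finally show "4 * real (card V) \<le> \<sigma> / 12 / 25 * real M" using V(2) by simp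
  qed (use c V(2) n(1) in auto)
  have size: "real (card V * (7 * (2 * t)) + M + card V + 1) \<le> \<kappa> * (real (card V) * real d)"
  proof -
    have "14 * real t \<le> 14 * (\<sigma> * real d)" using t(2) by simp
    also have "\<dots> \<le> \<kappa> / 4 * real d" using mult_right_mono[OF c(3), of "real d"] by simp
    finally have "real n * (14 * real t) \<le> real n * (\<kappa> / 4 * real d)" by (rule mult_left_mono) simp
    also have "\<dots> = \<kappa> * (real n * real d) / 4" by simp
    finally have "real (n * (7 * (2 * t))) \<le> \<kappa> * (real n * real d) / 4" by simp
    moreover have "8 * real n \<le> \<kappa> * real d * real n" using d(1) by (rule mult_right_mono) simp
    then have "8 * real n \<le> \<kappa> * (real n * real d)" by (simp only: mult_ac)
    moreover have "real n \<ge> 400" using n(1) by simp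
    ultimately show ?thesis using M(2) unfolding V(2) of_nat_add of_nat_1 by linarith
  qed
  have st: "2 * t > 0" "42 * (2 * t) \<le> 5 * d"
  proof -
    show "2 * t > 0" using t2(2) by simp
    have "84 * real t \<le> 84 * (\<sigma> * real d)" using t(2) by simp
    also have "\<dots> \<le> 84 * (1 / 84 * real d)" using c(2) by (intro mult_left_mono mult_right_mono) auto
    finally show "42 * (2 * t) \<le> 5 * d" by linarith
  qed
  have good: "UGraph V ` (R - Bad) \<subseteq> regular_graphs n d \<inter> {G. real d / 6 \<le> real (local_resilience G HAM)}"
  proof
    fix G assume "G \<in> UGraph V ` (R - Bad)"
    then obtain E where E: "E \<in> reg V d" "typical V d (2 * t) (\<sigma> / 12) \<kappa> E" "G = UGraph V E"
      unfolding Bad_def R_def by blast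
    have "d < 6 * local_resilience (UGraph V E) HAM"
      using typical_local_resilience[OF V(1) _ d0 st _ _ E(1,2) rounds size] V(2) n(1) c(1,2) by simp
    then have "real d / 6 \<le> real (local_resilience G HAM)" unfolding E(3) by linarith
    moreover have "G \<in> regular_graphs n d" unfolding regular_graphs_conv_reg E(3) using E(1) V_def by blast
    ultimately show "G \<in> regular_graphs n d \<inter> {G. real d / 6 \<le> real (local_resilience G HAM)}" by blast
  qed
  have inj: "inj_on (UGraph V) A" for A by (auto simp: inj_on_def)
  have cA: "card (regular_graphs n d) = card R"
    unfolding regular_graphs_conv_reg R_def V_def[symmetric] using inj by (rule card_image)
  have A: "finite (regular_graphs n d)" "regular_graphs n d \<noteq> {}"
    unfolding regular_graphs_conv_reg using R unfolding R_def V_def by auto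
  have "real (card R) - real (card Bad) \<le> real (card (R - Bad))"
    using R(1) diff_card_le_card_Diff[of Bad R] unfolding Bad_def by (simp add: of_nat_diff)
  also have "card (R - Bad) = card (UGraph V ` (R - Bad))" using inj by (simp add: card_image)
  also have "real \<dots> \<le> card (regular_graphs n d \<inter> {G. real d / 6 \<le> real (local_resilience G HAM)})"
    using good A(1) by (intro of_nat_mono card_mono) auto
  finally have "(1 - (8 / (\<sigma> * real n) + 2 * (4 / 5) ^ n)) * card R
    \<le> card (regular_graphs n d \<inter> {G. real d / 6 \<le> real (local_resilience G HAM)})"
    using bad by (simp add: algebra_simps)
  then show ?thesis
    unfolding random_regular_graph_def measure_pmf_of_set[OF A(2,1)] cA
    using cR by (simp add: pos_le_divide_eq)
qed

theorem theorem4: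
  fixes \<epsilon> :: real
  assumes "\<epsilon> > 0"
  shows "\<exists>d\<^sub>0::nat. d\<^sub>0 > 0 \<and> (\<forall>d\<ge>d\<^sub>0.
           ((\<lambda>n. measure_pmf.prob (random_regular_graph n d)
                  {G. real (local_resilience G HAM) \<ge> (1 - \<epsilon>) * real d / 6}) \<longlongrightarrow> 1)
             (inf sequentially (principal {n. even (d * n)})))"
proof -
  obtain \<sigma> \<kappa> \<kappa>' :: real where c: "0 < \<sigma>" "\<sigma> \<le> 1 / 84" "14 * \<sigma> \<le> \<kappa> / 4"
      "0 < \<kappa>" "\<kappa> \<le> 1 / 200 / 8" "\<kappa> * ln (200 / (1 / 200)\<^sup>2) \<le> (1 / 200)\<^sup>2 / 200"
      "0 < \<kappa>'" "\<kappa>' \<le> \<sigma> / 12 / 100 / 8" "\<kappa>' * ln (200 / (\<sigma> / 12 / 100)\<^sup>2) \<le> (\<sigma> / 12 / 100)\<^sup>2 / 200"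
    using resilience_constants by blast
  obtain T where T: "(1 / 2) ^ T < \<sigma> / 6" using real_arch_pow_inv[of "\<sigma> / 6" "1 / 2"] c(1) by auto
  have large: "\<forall>\<^sub>F d in sequentially. K \<le> q * real d" if "q > 0" for K q :: real
  proof -
    have "filterlim (\<lambda>d. q * real d) at_top sequentially"
      using that by (intro filterlim_tendsto_pos_mult_at_top[OF tendsto_const] filterlim_real_sequentially)
    then show ?thesis by (simp add: filterlim_at_top)
  qed
  have "\<forall>\<^sub>F d in sequentially. real T + 3 \<le> \<sigma> * real d \<and> 8 \<le> \<kappa> * real d \<and> 400 \<le> \<sigma> / 12 * \<kappa> * real d \<and>
      4 \<le> (\<sigma> / 12 / 100)\<^sup>2 / 200 * real d \<and> 4 \<le> (1 / 200)\<^sup>2 / 200 * real d"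
    using c(1,4) by (intro eventually_conj large) auto
  then obtain d\<^sub>0 where d\<^sub>0: "\<And>d. d \<ge> d\<^sub>0 \<Longrightarrow> real T + 3 \<le> \<sigma> * real d \<and> 8 \<le> \<kappa> * real d \<and>
      400 \<le> \<sigma> / 12 * \<kappa> * real d \<and> 4 \<le> (\<sigma> / 12 / 100)\<^sup>2 / 200 * real d \<and> 4 \<le> (1 / 200)\<^sup>2 / 200 * real d"
    unfolding eventually_sequentially by blast
  show ?thesis
  \<comment> \<open>The successor makes the threshold on \<open>d\<close> positive.\<close>
  proof (intro exI[of _ "Suc d\<^sub>0"] conjI allI impI)
    fix d assume "Suc d\<^sub>0 \<le> d"
    then have d: "real T + 3 \<le> \<sigma> * real d" "8 \<le> \<kappa> * real d" "400 \<le> \<sigma> / 12 * \<kappa> * real d"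
      "4 \<le> (\<sigma> / 12 / 100)\<^sup>2 / 200 * real d" "4 \<le> (1 / 200)\<^sup>2 / 200 * real d"
      using d\<^sub>0[of d] by simp_all
    define F where "F = inf sequentially (principal {n. even (d * n)})"
    define P where "P n = measure_pmf.prob (random_regular_graph n d)
      {G. real (local_resilience G HAM) \<ge> (1 - \<epsilon>) * real d / 6}" for n
    have "\<forall>\<^sub>F n in sequentially. 400 \<le> n \<and> 16 * d + 32 \<le> n \<and> 8 * real d + 16 \<le> 1 / 200 * real n \<and>
      8 * real d + 16 \<le> \<sigma> / 12 / 100 * real n"
      using c(1) by (intro eventually_conj large eventually_ge_at_top) auto
    \<comment> \<open>Parity is kept as a premise here and moved into the filter by
      \<open>eventually_inf_principal\<close>.\<close>
    then have "\<forall>\<^sub>F n in sequentially. even (d * n) \<longrightarrow> 1 - (8 / (\<sigma> * real n) + 2 * (4 / 5) ^ n) \<le> P n"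
    proof eventually_elim
      case (elim n)
      show ?case
      proof
        assume "even (d * n)"
        then have "1 - (8 / (\<sigma> * real n) + 2 * (4 / 5) ^ n)
          \<le> measure_pmf.prob (random_regular_graph n d) {G. real d / 6 \<le> real (local_resilience G HAM)}"
          using prob_resilience[OF c less_imp_le[OF T] d] elim by blast
        also have "\<dots> \<le> P n"
          unfolding P_def
        proof (rule measure_pmf.finite_measure_mono)
          have "(1 - \<epsilon>) * real d / 6 \<le> real d / 6" using assms by (simp add: mult_left_le_one_le algebra_simps)
          then show "{G. real d / 6 \<le> real (local_resilience G HAM)}
            \<subseteq> {G. real (local_resilience G HAM) \<ge> (1 - \<epsilon>) * real d / 6}" by auto
        qed simp
        finally show "1 - (8 / (\<sigma> * real n) + 2 * (4 / 5) ^ n) \<le> P n" .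
      qed
    qed
    then have low: "\<forall>\<^sub>F n in F. 1 - (8 / (\<sigma> * real n) + 2 * (4 / 5) ^ n) \<le> P n"
      unfolding F_def by (simp add: eventually_inf_principal)
    have "(\<lambda>n. 1 - (8 / \<sigma> * (1 / real n) + 2 * (4 / 5) ^ n)) \<longlonglongrightarrow> 1 - (8 / \<sigma> * 0 + 2 * 0)"
      by (intro tendsto_intros lim_1_over_n LIMSEQ_power_zero) auto
    then have "(\<lambda>n. 1 - (8 / (\<sigma> * real n) + 2 * (4 / 5) ^ n)) \<longlonglongrightarrow> 1" by simp
    then have lim: "((\<lambda>n. 1 - (8 / (\<sigma> * real n) + 2 * (4 / 5) ^ n)) \<longlongrightarrow> 1) F"
      unfolding F_def by (rule tendsto_mono[rotated]) simp
    have "(P \<longlongrightarrow> 1) F"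
      by (rule tendsto_sandwich[OF low _ lim tendsto_const]) (simp add: P_def)
    then show "((\<lambda>n. measure_pmf.prob (random_regular_graph n d)
        {G. real (local_resilience G HAM) \<ge> (1 - \<epsilon>) * real d / 6}) \<longlongrightarrow> 1)
      (inf sequentially (principal {n. even (d * n)}))"
      unfolding P_def F_def .
  qed simp
qed

end
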